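(* Let $A_i\in\mathbb{R}^{n\times n}$, $C_i\in\mathbb{R}^{n_y\times n}$ ($i=1,\ldots,N$), $E_u\in\mathbb{R}^{n\times n_u}$, $F_u\in\mathbb{R}^{n_y\times n_u}$ be entrywise nonnegative (so the system below is positive), let $h_1,\ldots,h_N>0$ be constant delays, and consider $$x(t)=\sum_{i=1}^NA_ix(t-h_i)+E_uu(t),\qquad y(t)=\sum_{i=1}^NC_ix(t-h_i)+F_uu(t).$$ Write $\mathcal{A}:=(\mathbf{1}_N\otimes I_n)[A_1\ \cdots\ A_N]\in\mathbb{R}^{nN\times nN}$, $\mathcal{E}:=\mathbf{1}_N\otimes E_u\in\mathbb{R}^{nN\times n_u}$ (the vertical stack of $N$ copies of $E_u$) and $\mathcal{C}:=[C_1\ \cdots\ C_N]$. Then: (i) The system is asymptotically stable and has $L_1$-gain smaller than $\gamma_1$ if and only if there exists $\mu\in\mathbb{R}^{nN}_{>0}$ such that $$\begin{bmatrix}\mu\\ \mathbf{1}_{n_y}\end{bmatrix}^T\begin{bmatrix}\mathcal{A} & \mathcal{E}\\ \mathcal{C} & F_u\end{bmatrix}<\begin{bmatrix}\mu\\ \gamma_1\mathbf{1}_{n_u}\end{bmatrix}^T.$$ (ii) The system is asymptotically stable and has $L_2$-gain smaller than $\gamma_2$ if and only if there exist diagonal positive definite $Q_1,\ldots,Q_N\in\mathbb{R}^{n\times n}$ such that, with $Q:=\mathrm{diag}(Q_1,\ldots,Q_N)$, $$\begin{bmatrix}-Q & \star & \star & \star\\ 0 & -\gamma_2I_{n_u}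 & \star & \star\\ \begin{bmatrix}Q_1\\ \vdots\\ Q_N\end{bmatrix}[A_1\ \cdots\ A_N] & \begin{bmatrix}Q_1E_u\\ \vdots\\ Q_NE_u\end{bmatrix} & -Q & \star\\ \mathcal{C} & F_u & 0 & -\gamma_2I_{n_y}\end{bmatrix}\prec0.$$ (iii) The system is asymptotically stable and has $L_\infty$-gain smaller than $\gamma_\infty$ if and only if there exists $\mu\in\mathbb{R}^{nN}_{>0}$ such that $$\begin{bmatrix}\mathcal{A} & \mathcal{E}\\ \mathcal{C} & F_u\end{bmatrix}\begin{bmatrix}\mu\\ \mathbf{1}_{n_u}\end{bmatrix}<\begin{bmatrix}\mu\\ \gamma_\infty\mathbf{1}_{n_y}\end{bmatrix}.$$
   Context: $\mathbf{1}_k$ is the vector of ones and $\otimes$ the Kronecker product; vector inequalities are componentwise; $\star$ denotes the transpose of the symmetric block; $\prec0$ means negative definite. Asymptotic stability refers to the unforced equation ($u=0$). The $L_p$-gain is the induced gain of $u\mapsto y$ with zero initial conditions, with $\|w\|_{L_p}=(\int_0^\infty\|w(t)\|_p^pdt)^{1/p}$ for $p=1,2$ and $\|w\|_{L_\infty}=\operatorname{ess\,sup}_t\|w(t)\|_\infty$. *)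

theory Defs
  imports "HOL-Analysis.Analysis" "HOL-Probability.Essential_Supremum"
begin

(* Matrices are HOL-Analysis matrices: M :: real^'c^'r has rows indexed by 'r,
   columns by 'c.  Dimensions are finite index types:
   N = CARD('i), n = CARD('n), n_u = CARD('u), n_y = CARD('y).
   R^{nN} is indexed by 'i \<times> 'n (block index first, as in the Kronecker product),
   block vectors/matrices by sum types. *)

definition nonneg_mat :: "real^'c^'r \<Rightarrow> bool" where
  "nonneg_mat M \<longleftrightarrow> (\<forall>i j. 0 \<le> M $ i $ j)"

definition vlt :: "real^'a \<Rightarrow> real^'a \<Rightarrow> bool" where
  "vlt x y \<longleftrightarrow> (\<forall>i. x $ i < y $ i)"

definition is_diag :: "real^'n^'n \<Rightarrow> bool" where
  "is_diag M \<longleftrightarrow> (\<forall>i j. i \<noteq> j \<longrightarrow> M $ i $ j = 0)"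

definition pos_def :: "real^'n^'n \<Rightarrow> bool" where
  "pos_def M \<longleftrightarrow> transpose M = M \<and> (\<forall>x. x \<noteq> 0 \<longrightarrow> 0 < x \<bullet> (M *v x))"

definition neg_def :: "real^'n^'n \<Rightarrow> bool" where
  "neg_def M \<longleftrightarrow> transpose M = M \<and> (\<forall>x. x \<noteq> 0 \<longrightarrow> x \<bullet> (M *v x) < 0)"

definition vcat :: "real^'a \<Rightarrow> real^'b \<Rightarrow> real^('a + 'b)" where
  "vcat v w = (\<chi> k. case k of Inl i \<Rightarrow> v $ i | Inr j \<Rightarrow> w $ j)"

definition blk :: "real^'c1^'r1 \<Rightarrow> real^'c2^'r1 \<Rightarrow> real^'c1^'r2 \<Rightarrow> real^'c2^'r2
    \<Rightarrow> real^('c1 + 'c2)^('r1 + 'r2)" where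
  "blk M11 M12 M21 M22 = (\<chi> r. \<chi> c.
     (case r of Inl r1 \<Rightarrow> (case c of Inl c1 \<Rightarrow> M11 $ r1 $ c1 | Inr c2 \<Rightarrow> M12 $ r1 $ c2)
              | Inr r2 \<Rightarrow> (case c of Inl c1 \<Rightarrow> M21 $ r2 $ c1 | Inr c2 \<Rightarrow> M22 $ r2 $ c2)))"

definition ones_kron :: "real^'c^'r \<Rightarrow> real^'c^('i::finite \<times> 'r)" where
  "ones_kron M = (\<chi> p. M $ snd p)"

definition blockrow :: "('i::finite \<Rightarrow> real^'c^'r) \<Rightarrow> real^('i \<times> 'c)^'r" where
  "blockrow M = (\<chi> r. \<chi> q. M (fst q) $ r $ snd q)"

definition blockcol :: "('i::finite \<Rightarrow> real^'c^'r) \<Rightarrow> real^'c^('i \<times> 'r)" where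
  "blockcol M = (\<chi> p. M (fst p) $ snd p)"

definition blockdiag :: "('i::finite \<Rightarrow> real^'n^'n) \<Rightarrow> real^('i \<times> 'n)^('i \<times> 'n)" where
  "blockdiag M = (\<chi> p. \<chi> q. if fst p = fst q then M (fst p) $ snd p $ snd q else 0)"

definition norm1 :: "real^'a \<Rightarrow> real" where
  "norm1 v = (\<Sum>i\<in>UNIV. \<bar>v $ i\<bar>)"

definition norminf :: "real^'a \<Rightarrow> real" where
  "norminf v = Max (range (\<lambda>i. \<bar>v $ i\<bar>))"

definition is_traj ::
  "('i::finite \<Rightarrow> real^'n^'n) \<Rightarrow> real^'u^'n \<Rightarrow> ('i \<Rightarrow> real) \<Rightarrow> (real \<Rightarrow> real^'u)
    \<Rightarrow> (real \<Rightarrow> real^'n) \<Rightarrow> bool" where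
  "is_traj A Eu h u x \<longleftrightarrow>
     (\<forall>t\<ge>0. x t = (\<Sum>i\<in>UNIV. A i *v x (t - h i)) + Eu *v u t)"

definition sys_output ::
  "('i::finite \<Rightarrow> real^'n^'y) \<Rightarrow> real^'u^'y \<Rightarrow> ('i \<Rightarrow> real) \<Rightarrow> (real \<Rightarrow> real^'u)
    \<Rightarrow> (real \<Rightarrow> real^'n) \<Rightarrow> real \<Rightarrow> real^'y" where
  "sys_output C Fu h u x t = (\<Sum>i\<in>UNIV. C i *v x (t - h i)) + Fu *v u t"

definition asym_stable :: "('i::finite \<Rightarrow> real^'n^'n) \<Rightarrow> ('i \<Rightarrow> real) \<Rightarrow> bool" where
  "asym_stable A h \<longleftrightarrow>
     (\<forall>x. bounded (x ` {- Max (range h)..<0}) \<and>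
          (\<forall>t\<ge>0. x t = (\<Sum>i\<in>UNIV. A i *v x (t - h i)))
          \<longrightarrow> (x \<longlongrightarrow> 0) at_top)"

definition L1_sig :: "(real \<Rightarrow> real^'a) \<Rightarrow> bool" where
  "L1_sig w \<longleftrightarrow> w \<in> borel_measurable lborel \<and> set_integrable lborel {0..} (\<lambda>t. norm1 (w t))"

definition L1_norm :: "(real \<Rightarrow> real^'a) \<Rightarrow> real" where
  "L1_norm w = (LINT t:{0..}|lborel. norm1 (w t))"

definition L2_sig :: "(real \<Rightarrow> real^'a) \<Rightarrow> bool" where
  "L2_sig w \<longleftrightarrow> w \<in> borel_measurable lborel \<and> set_integrable lborel {0..} (\<lambda>t. (norm (w t))\<^sup>2)"

definition L2_norm :: "(real \<Rightarrow> real^'a) \<Rightarrow> real" where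
  "L2_norm w = sqrt (LINT t:{0..}|lborel. (norm (w t))\<^sup>2)"

definition Linf_norm :: "(real \<Rightarrow> real^'a) \<Rightarrow> ereal" where
  "Linf_norm w = esssup (restrict_space lborel {0..}) (\<lambda>t. ereal (norminf (w t)))"

definition Linf_sig :: "(real \<Rightarrow> real^'a) \<Rightarrow> bool" where
  "Linf_sig w \<longleftrightarrow> w \<in> borel_measurable lborel \<and> Linf_norm w < \<infinity>"

(* L_p-gain (zero initial conditions) smaller than \<gamma>:
   the induced gain sup ||y||/||u|| is < \<gamma>, i.e. some \<gamma>' < \<gamma> bounds it *)
definition L1_gain_lt ::
  "('i::finite \<Rightarrow> real^'n^'n) \<Rightarrow> ('i \<Rightarrow> real^'n^'y) \<Rightarrow> real^'u^'n \<Rightarrow> real^'u^'y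
     \<Rightarrow> ('i \<Rightarrow> real) \<Rightarrow> real \<Rightarrow> bool" where
  "L1_gain_lt A C Eu Fu h \<gamma> \<longleftrightarrow> (\<exists>\<gamma>'. 0 \<le> \<gamma>' \<and> \<gamma>' < \<gamma> \<and>
     (\<forall>u x. L1_sig u \<and> (\<forall>t<0. x t = 0) \<and> is_traj A Eu h u x \<longrightarrow>
        L1_sig (sys_output C Fu h u x) \<and> L1_norm (sys_output C Fu h u x) \<le> \<gamma>' * L1_norm u))"

definition L2_gain_lt ::
  "('i::finite \<Rightarrow> real^'n^'n) \<Rightarrow> ('i \<Rightarrow> real^'n^'y) \<Rightarrow> real^'u^'n \<Rightarrow> real^'u^'y
     \<Rightarrow> ('i \<Rightarrow> real) \<Rightarrow> real \<Rightarrow> bool" where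
  "L2_gain_lt A C Eu Fu h \<gamma> \<longleftrightarrow> (\<exists>\<gamma>'. 0 \<le> \<gamma>' \<and> \<gamma>' < \<gamma> \<and>
     (\<forall>u x. L2_sig u \<and> (\<forall>t<0. x t = 0) \<and> is_traj A Eu h u x \<longrightarrow>
        L2_sig (sys_output C Fu h u x) \<and> L2_norm (sys_output C Fu h u x) \<le> \<gamma>' * L2_norm u))"

definition Linf_gain_lt ::
  "('i::finite \<Rightarrow> real^'n^'n) \<Rightarrow> ('i \<Rightarrow> real^'n^'y) \<Rightarrow> real^'u^'n \<Rightarrow> real^'u^'y
     \<Rightarrow> ('i \<Rightarrow> real) \<Rightarrow> real \<Rightarrow> bool" where
  "Linf_gain_lt A C Eu Fu h \<gamma> \<longleftrightarrow> (\<exists>\<gamma>'. 0 \<le> \<gamma>' \<and> \<gamma>' < \<gamma> \<and>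
     (\<forall>u x. Linf_sig u \<and> (\<forall>t<0. x t = 0) \<and> is_traj A Eu h u x \<longrightarrow>
        Linf_sig (sys_output C Fu h u x) \<and>
        Linf_norm (sys_output C Fu h u x) \<le> ereal \<gamma>' * Linf_norm u))"

end

theory Submission
  imports Defs
begin

text \<open>
  Let \<open>At\<close> and \<open>Ct\<close> be the sums of the \<open>A i\<close> and of the \<open>C i\<close>. A constant initial function \<open>v \<ge> 0\<close> with
  \<open>At v \<ge> v\<close> generates a trajectory that stays above \<open>v\<close>, so by a theorem of the alternative asymptotic
  stability yields a positive \<open>m\<close> with \<open>At m < m\<close> and a nonnegative resolvent \<open>R = (I - At)\<inverse>\<close>;
  conversely such an \<open>m\<close> makes \<open>\<bar>x\<bar>\<close> contract over each interval of length \<open>max h\<close>.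

  Inputs that are constant on a long interval show that each gain is at least the corresponding induced
  norm of the static gain \<open>G = Ct R Eu + Fu\<close>; for the step response this holds because its deviation from
  equilibrium is an unforced trajectory. A bound on this norm is turned into a certificate by solving with
  \<open>R\<close> for the equilibrium state or costate, perturbed to make the inequalities strict. For \<open>p = 2\<close> the
  diagonal \<open>Q i\<close> are quotients of costate and state, taken at a positive vector \<open>w\<close> with
  \<open>G\<^sup>T G w < \<gamma>\<^sup>2 w\<close>, and the LMI follows from the Schur test.

  Conversely, a certificate for \<open>p = 1\<close> or \<open>p = 2\<close> gives storage functions \<open>f i\<close> (linear in \<open>\<bar>x\<bar>\<close>, respectively
  quadratic in \<open>x\<close>) whose delayed differences dominate the supply rate pointwise; integrating bounds the
  gain. For \<open>p = \<infinity>\<close> the certificate is an invariant bound on \<open>\<bar>x\<bar>\<close>.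
\<close>

subsection \<open>Nonnegative matrices\<close>

lemma sum_matrix_vector_mult: "(\<Sum>i\<in>I. M i) *v (x::real^'c) = (\<Sum>i\<in>I. M i *v x)"
  by (induction I rule: infinite_finite_induct) (auto simp: matrix_vector_mult_add_rdistrib)

lemma vector_matrix_mult_sum: "(x::real^'r) v* (\<Sum>i\<in>I. M i) = (\<Sum>i\<in>I. x v* M i)"
  by (induction I rule: infinite_finite_induct) (auto simp: vector_matrix_mult_add_rdistrib)

lemma nonneg_mat_sum: "(\<And>i. i \<in> I \<Longrightarrow> nonneg_mat (M i)) \<Longrightarrow> nonneg_mat (\<Sum>i\<in>I. M i)"
  by (simp add: nonneg_mat_def sum_nonneg)

lemma nonneg_mat_mult: "nonneg_mat M \<Longrightarrow> nonneg_mat M' \<Longrightarrow> nonneg_mat (M ** M')"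
  by (simp add: nonneg_mat_def matrix_matrix_mult_def sum_nonneg)

lemma nonneg_mat_transpose: "nonneg_mat M \<Longrightarrow> nonneg_mat (transpose M)"
  by (simp add: nonneg_mat_def transpose_def)

lemma nonneg_mat_mono:
  fixes x y :: "real^'c"
  shows "nonneg_mat M \<Longrightarrow> x \<le> y \<Longrightarrow> M *v x \<le> M *v y"
  by (auto simp: nonneg_mat_def less_eq_vec_def matrix_vector_mult_def intro!: sum_mono mult_left_mono)

lemma nonneg_mat_mono_left:
  fixes x y :: "real^'r"
  shows "nonneg_mat M \<Longrightarrow> x \<le> y \<Longrightarrow> x v* M \<le> y v* M"
  by (auto simp: nonneg_mat_def less_eq_vec_def vector_matrix_mult_def intro!: sum_mono mult_right_mono)

lemma nonneg_mat_mult_nonneg: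
  fixes x :: "real^'c"
  shows "nonneg_mat M \<Longrightarrow> 0 \<le> x \<Longrightarrow> 0 \<le> M *v x"
  using nonneg_mat_mono[of M 0 x] by simp

lemma nonneg_mat_mult_nonneg_left:
  fixes x :: "real^'r"
  shows "nonneg_mat M \<Longrightarrow> 0 \<le> x \<Longrightarrow> 0 \<le> x v* M"
  using nonneg_mat_mono_left[of M 0 x] by simp

lemma abs_matrix_vector_mult_le:
  fixes x :: "real^'c"
  assumes "nonneg_mat M"
  shows "\<bar>M *v x\<bar> \<le> M *v \<bar>x\<bar>"
  using assms
  by (auto simp: nonneg_mat_def less_eq_vec_def matrix_vector_mult_def abs_vec_def abs_mult
        intro!: order_trans[OF sum_abs] sum_mono)

lemma inner_mono_vec:
  fixes s x y :: "real^'n"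
  shows "0 \<le> s \<Longrightarrow> x \<le> y \<Longrightarrow> s \<bullet> x \<le> s \<bullet> y"
  by (auto simp: less_eq_vec_def inner_vec_def intro!: sum_mono mult_left_mono)

lemma inner_mono_vec_left:
  fixes s x y :: "real^'n"
  shows "0 \<le> s \<Longrightarrow> x \<le> y \<Longrightarrow> x \<bullet> s \<le> y \<bullet> s"
  using inner_mono_vec by (metis inner_commute)

lemma vlt_imp_le: "vlt x y \<Longrightarrow> x \<le> y"
  by (auto simp: vlt_def less_eq_vec_def less_imp_le)

lemma vlt_le_trans: "x \<le> y \<Longrightarrow> vlt y z \<Longrightarrow> vlt x z"
  by (auto simp: vlt_def less_eq_vec_def intro: le_less_trans)

lemma finite_pos_lower_bound:
  fixes f :: "'a::finite \<Rightarrow> real"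
  assumes "\<And>i. 0 < f i"
  shows "\<exists>c>0. \<forall>i. c \<le> f i"
proof (intro exI conjI allI)
  show "0 < Min (range f)" using assms by simp
  show "Min (range f) \<le> f i" for i by simp
qed

text \<open>Finitely many strict inequalities leave a common margin. The divisor
  \<open>1 + \<bar>c $ i\<bar>\<close> is never zero and keeps the perturbed inequality strict. This
  supplies the slack \<open>\<epsilon>\<close> that later makes the equilibrium equations into
  strict certificates.\<close>

lemma vlt_perturb:
  fixes a b c :: "real^'n"
  assumes "vlt a b"
  shows "\<exists>\<epsilon>>0. vlt (a + \<epsilon> *\<^sub>R c) b"
proof -
  have "\<And>i. 0 < (b $ i - a $ i) / (1 + \<bar>c $ i\<bar>)"
    using assms by (auto simp: vlt_def intro!: divide_pos_pos)
  from finite_pos_lower_bound[of "\<lambda>i. (b $ i - a $ i) / (1 + \<bar>c $ i\<bar>)", OF this] obtain e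
    where e: "e > 0" "\<And>i. e \<le> (b $ i - a $ i) / (1 + \<bar>c $ i\<bar>)" by blast
  have "a $ i + e * c $ i < b $ i" for i
  proof -
    have "e * (1 + \<bar>c $ i\<bar>) \<le> b $ i - a $ i"
      using e(2)[of i] by (simp add: pos_le_divide_eq)
    moreover have "e * c $ i < e * (1 + \<bar>c $ i\<bar>)"
      using e(1) by (intro mult_strict_left_mono) auto
    ultimately show ?thesis by linarith
  qed
  then show ?thesis using e(1) by (auto simp: vlt_def)
qed

text \<open>Minimum-ratio argument: if some entry of \<open>w\<close> is negative, let
  \<open>- c\<close> be the least ratio of \<open>w\<close> to \<open>m\<close>, attained at
  \<open>k\<close>. Then \<open>w\<close> dominates \<open>- c\<close> times \<open>m\<close>, hence
  also \<open>- c\<close> times \<open>A *v m\<close>, and at \<open>k\<close> the latter exceeds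
  \<open>- c * m $ k = w $ k\<close>.\<close>

lemma dominated_nonneg:
  fixes A :: "real^'n^'n"
  assumes A: "nonneg_mat A" and m: "vlt 0 m" "vlt (A *v m) m" and w: "A *v w \<le> w"
  shows "0 \<le> w"
proof (rule ccontr)
  assume "\<not> 0 \<le> w"
  then obtain i0 where i0: "w $ i0 < 0" by (auto simp: less_eq_vec_def not_le)
  have mp: "0 < m $ i" for i using m(1) by (simp add: vlt_def)
  define c where "c = Max (range (\<lambda>i. - w $ i / m $ i))"
  have cge: "- w $ i / m $ i \<le> c" for i unfolding c_def by simp
  have "c \<in> range (\<lambda>i. - w $ i / m $ i)" unfolding c_def by (rule Max_in) auto
  then obtain k where k: "c = - w $ k / m $ k" by auto
  have "0 < - w $ i0 / m $ i0" using i0 mp[of i0] by (intro divide_pos_pos) auto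
  then have c0: "0 < c" using cge[of i0] by linarith
  have "- c * m $ i \<le> w $ i" for i
    using cge[of i] mp[of i] by (simp only: pos_divide_le_eq)
  then have "(- c) *\<^sub>R m \<le> w" by (simp add: less_eq_vec_def)
  then have "A *v ((- c) *\<^sub>R m) \<le> w"
    using nonneg_mat_mono[OF A] w order_trans by blast
  then have "- c * (A *v m) $ k \<le> w $ k"
    unfolding matrix_vector_mult_scaleR less_eq_vec_def by (metis vector_scaleR_component real_scaleR_def)
  moreover have "c * (A *v m) $ k < c * m $ k"
    using m(2) c0 by (simp add: vlt_def)
  moreover have "c * m $ k = - w $ k" using k mp[of k] by simp
  ultimately show False by simp
qed

text \<open>\<open>dominated_nonneg\<close> does all the work, in place of a Neumann series: applied
  to \<open>w\<close> and \<open>- w\<close> it shows that the kernel of \<open>mat 1 - A\<close> is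
  trivial, and applied to \<open>R *v b\<close> it shows that the inverse preserves
  nonnegativity.\<close>

lemma resolvent_exists:
  fixes A :: "real^'n^'n"
  assumes A: "nonneg_mat A" and m: "vlt 0 m" "vlt (A *v m) m"
  obtains R where "nonneg_mat R" "(mat 1 - A) ** R = mat 1" "R ** (mat 1 - A) = mat 1"
proof -
  have "w = 0" if "(mat 1 - A) *v w = 0" for w
  proof -
    have "A *v w = w" using that by (simp add: matrix_vector_mult_diff_rdistrib)
    then have "0 \<le> w" "0 \<le> - w"
      using dominated_nonneg[OF A m, of w] dominated_nonneg[OF A m, of "- w"]
      by (auto simp: matrix_vector_mult_diff_distrib[of A 0 w, simplified])
    then show ?thesis by simp
  qed
  then obtain R where R: "R ** (mat 1 - A) = mat 1"
    using matrix_left_invertible_ker by blast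
  then have R': "(mat 1 - A) ** R = mat 1" using matrix_left_right_inverse by blast
  have "0 \<le> R *v b" if b: "0 \<le> b" for b
  proof -
    have "(mat 1 - A) *v (R *v b) = b" by (simp add: matrix_vector_mul_assoc R')
    then have "R *v b = A *v (R *v b) + b" 
      by (simp add: matrix_vector_mult_diff_rdistrib algebra_simps)
    then have "A *v (R *v b) \<le> R *v b" using b by (metis add_increasing2 order_refl)
    then show ?thesis using dominated_nonneg[OF A m] by blast
  qed
  then have "0 \<le> (R *v axis j 1) $ i" for i j
    by (simp add: less_eq_vec_def axis_def)
  then have "nonneg_mat R" 
    by (simp add: nonneg_mat_def matrix_vector_mult_basis column_def)
  then show ?thesis using that R R' by blast
qed

text \<open>If no such \<open>s\<close> exists, the convex cone \<open>S\<close> of all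
  \<open>s - s v* A\<close> with positive \<open>s\<close> misses the open positive cone
  \<open>T\<close>. The normal \<open>a\<close> of a separating hyperplane is nonnegative on
  \<open>T\<close> and nonpositive on \<open>S\<close>, which says that \<open>0 \<le> a\<close> and
  \<open>a \<le> A *v a\<close>, against the hypothesis.\<close>

lemma nonneg_mat_alternative:
  fixes A :: "real^'n^'n"
  assumes A: "nonneg_mat A" and no: "\<And>v. 0 \<le> v \<Longrightarrow> v \<le> A *v v \<Longrightarrow> v = 0"
  shows "\<exists>s. vlt 0 s \<and> vlt (s v* A) s"
proof (rule ccontr)
  assume none: "\<not> ?thesis"
  define S where "S = (\<lambda>s. s - s v* A) ` {s. \<forall>i. s $ i \<in> {0<..}}"
  define T where "T = {w :: real^'n. \<forall>i. w $ i \<in> {0<..}}"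
  have cT: "convex T" unfolding T_def
    by (rule convex_box_cart) (metis Collect_mem_eq convex_real_interval(3))
  have lin: "linear (\<lambda>s. s - s v* A)"
    by (auto simp: linear_iff vector_matrix_left_distrib scaleR_vector_matrix_assoc scaleR_diff_right)
  have cS: "convex S" unfolding S_def using cT unfolding T_def by (intro convex_linear_image lin)
  have one: "(1::real^'n) \<in> T" by (simp add: T_def)
  have disj: "S \<inter> T = {}"
    using none by (auto simp: S_def T_def vlt_def)
  have "S \<noteq> {}" using one unfolding S_def T_def by blast
  then obtain a b where a: "a \<noteq> 0" and bS: "\<forall>x\<in>S. a \<bullet> x \<le> b" and bT: "\<forall>x\<in>T. b \<le> a \<bullet> x"
    using separating_hyperplane_sets[OF cS cT _ _ disj] one by blast
  have scaleS: "c *\<^sub>R x \<in> S" if "0 < c" "x \<in> S" for c x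
  proof -
    from that obtain s where "x = s - s v* A" "\<forall>i. s $ i > 0" by (auto simp: S_def)
    then have "c *\<^sub>R x = c *\<^sub>R s - (c *\<^sub>R s) v* A" "\<forall>i. (c *\<^sub>R s) $ i > 0"
      using that by (auto simp: scaleR_vector_matrix_assoc scaleR_diff_right)
    then show ?thesis by (auto simp: S_def intro!: image_eqI[where x = "c *\<^sub>R s"])
  qed
  have scaleT: "c *\<^sub>R x \<in> T" if "0 < c" "x \<in> T" for c x
    using that by (auto simp: T_def)
  \<comment> \<open>Both sets are closed under positive scaling, so the separating level may be
    taken to be 0: small multiples of \<open>1\<close> in \<open>T\<close> force
    \<open>b \<le> 0\<close>, and a negative value of \<open>a\<close> on \<open>T\<close> could be
    scaled to \<open>b - 1\<close>.\<close>
  have b0: "b \<le> 0"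
  proof (rule field_le_epsilon)
    fix e :: real assume e: "e > 0"
    define c where "c = e / (1 + \<bar>a \<bullet> 1\<bar>)"
    have "c > 0" using e by (auto simp: c_def intro!: divide_pos_pos)
    then have "b \<le> c * (a \<bullet> 1)" using bT scaleT[OF _ one] by force
    also have "\<dots> \<le> c * (1 + \<bar>a \<bullet> 1\<bar>)" using \<open>c > 0\<close> by (intro mult_left_mono) auto
    also have "\<dots> = e" by (simp add: c_def)
    finally show "b \<le> 0 + e" by simp
  qed
  have Sle: "a \<bullet> x \<le> 0" if "x \<in> S" for x
    using bS b0 that by force
  have Tge: "0 \<le> a \<bullet> x" if "x \<in> T" for x
  proof (rule ccontr)
    assume neg: "\<not> 0 \<le> a \<bullet> x"
    define c where "c = (b - 1) / (a \<bullet> x)"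
    have "c > 0" using neg b0 by (auto simp: c_def intro!: divide_neg_neg)
    then have "b \<le> c * (a \<bullet> x)" using bT scaleT[OF _ that] by force
    then show False using neg by (simp add: c_def)
  qed
  \<comment> \<open>Passage from the open cone to its closure, so that the unit vectors, which lie
    on the boundary, can be tested.\<close>
  have cone: "0 \<le> p \<bullet> w" if "\<And>x. x \<in> T \<Longrightarrow> 0 \<le> p \<bullet> x" "0 \<le> w" for p w :: "real^'n"
  proof (rule field_le_epsilon)
    fix e :: real assume e: "e > 0"
    define c where "c = e / (1 + \<bar>p \<bullet> 1\<bar>)"
    have "c > 0" using e by (auto simp: c_def intro!: divide_pos_pos)
    then have "w + c *\<^sub>R 1 \<in> T" using that(2) by (auto simp: T_def less_eq_vec_def add_nonneg_pos)
    then have "0 \<le> p \<bullet> w + c * (p \<bullet> 1)" using that(1) by (fastforce simp: inner_add_right)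
    also have "\<dots> \<le> p \<bullet> w + c * (1 + \<bar>p \<bullet> 1\<bar>)" using \<open>c > 0\<close> by (intro add_left_mono mult_left_mono) auto
    also have "\<dots> = p \<bullet> w + e" by (simp add: c_def)
    finally show "0 \<le> p \<bullet> w + e" .
  qed
  have axis_nonneg: "0 \<le> (axis i 1 :: real^'n)" for i by (simp add: less_eq_vec_def axis_def)
  have a0: "0 \<le> a"
    using cone[OF Tge axis_nonneg] by (simp add: less_eq_vec_def inner_axis)
  have "0 \<le> (A *v a - a) \<bullet> x" if "x \<in> T" for x
  proof -
    have "x - x v* A \<in> S" using that by (auto simp: S_def T_def)
    from Sle[OF this] show ?thesis
      by (simp add: inner_diff_right inner_diff_left dot_lmul_matrix inner_commute[of a])
        (simp add: inner_commute)
  qed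
  from cone[OF this axis_nonneg] have "a \<le> A *v a"
    by (simp add: less_eq_vec_def inner_axis)
  then show False using no[OF a0] a by blast
qed

text \<open>The row certificate is a column certificate for \<open>transpose A\<close>, which
  therefore has a nonnegative resolvent \<open>R\<close>; the row vector \<open>1 v* R\<close>
  solves \<open>m = A *v m + 1\<close>. The alternative delivers rows, while the decay estimate and
  the resolvent of \<open>A\<close> need columns.\<close>

lemma vlt_left_imp_right:
  fixes A :: "real^'n^'n"
  assumes A: "nonneg_mat A" and s: "vlt 0 s" "vlt (s v* A) s"
  shows "\<exists>m. vlt 0 m \<and> vlt (A *v m) m"
proof -
  obtain R where R: "nonneg_mat R" "(mat 1 - transpose A) ** R = mat 1" "R ** (mat 1 - transpose A) = mat 1"
    using resolvent_exists[of "transpose A" s] nonneg_mat_transpose[OF A] s by auto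
  define m where "m = 1 v* R"
  have m0: "0 \<le> m" unfolding m_def using R(1)
    by (intro nonneg_mat_mult_nonneg_left) (auto simp: less_eq_vec_def)
  have "m v* (mat 1 - transpose A) = 1" by (simp add: m_def vector_matrix_mul_assoc R)
  then have eq: "m = A *v m + 1" by (simp add: vector_matrix_mult_diff_rdistrib algebra_simps)
  have "vlt (A *v m) m" by (subst (2) eq) (simp add: vlt_def)
  moreover from this have "vlt 0 m"
    using nonneg_mat_mult_nonneg[OF A m0] vlt_le_trans by blast
  ultimately show ?thesis by blast
qed

subsection \<open>Trajectories of the delay equation\<close>

text \<open>The number of steps of length \<open>\<delta>\<close> back to negative time drops at
  each lag. The \<open>+ 1\<close> matters: on the first interval after 0 the measure is 1, whereas
  negative times have measure 0.\<close>

lemma wf_delay: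
  fixes \<delta> :: real
  assumes "0 < \<delta>"
  shows "wf {(s, t). 0 \<le> t \<and> s \<le> t - \<delta>}"
proof (rule wf_subset[OF wf_measure[of "\<lambda>t. nat (\<lfloor>t / \<delta>\<rfloor> + 1)"]], safe)
  fix s t :: real assume t: "0 \<le> t" "s \<le> t - \<delta>"
  have "s / \<delta> \<le> t / \<delta> - 1" using t(2) assms by (simp add: field_simps)
  then have "\<lfloor>s / \<delta>\<rfloor> \<le> \<lfloor>t / \<delta>\<rfloor> - 1"
    using floor_mono[of "s / \<delta>" "t / \<delta> - 1"] by simp
  moreover have "0 \<le> \<lfloor>t / \<delta>\<rfloor>" using t(1) assms by simp
  ultimately show "(s, t) \<in> Wellfounded.measure (\<lambda>t. nat (\<lfloor>t / \<delta>\<rfloor> + 1))" by simp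
qed

text \<open>The method of steps as an induction rule on real time: the history before
  \<open>t0\<close> is the base case, and every later instant may rely on all instants at least
  \<open>\<delta>\<close> earlier.\<close>

lemma delay_induct:
  fixes \<delta> t0 t :: real
  assumes \<delta>: "0 < \<delta>" and init: "\<And>t. t < t0 \<Longrightarrow> P t"
    and step: "\<And>t. t0 \<le> t \<Longrightarrow> (\<And>s. s \<le> t - \<delta> \<Longrightarrow> P s) \<Longrightarrow> P t"
  shows "P t"
proof -
  have "P (t0 + r)" for r
  proof (induction r rule: wf_induct_rule[OF wf_delay[OF \<delta>]])
    case (1 r)
    show ?case
    proof (cases "0 \<le> r")
      case True
      have "P s" if "s \<le> t0 + r - \<delta>" for s
        using 1[of "s - t0"] that True by auto
      then show ?thesis using step[of "t0 + r"] True by simp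
    qed (use init in simp)
  qed
  from this[of "t - t0"] show ?thesis by simp
qed

locale positive_delay_system =
  fixes A :: "'i::finite \<Rightarrow> real^'n::finite^'n"
    and C :: "'i \<Rightarrow> real^'n^'y::finite"
    and Eu :: "real^'u::finite^'n"
    and Fu :: "real^'u^'y"
    and h :: "'i \<Rightarrow> real"
  assumes A_nonneg: "\<And>i. nonneg_mat (A i)"
    and C_nonneg: "\<And>i. nonneg_mat (C i)"
    and Eu_nonneg: "nonneg_mat Eu"
    and Fu_nonneg: "nonneg_mat Fu"
    and h_pos: "\<And>i. 0 < h i"
begin

definition \<delta> where "\<delta> = Min (range h)"

lemma \<delta>_pos: "0 < \<delta>" and \<delta>_le: "\<delta> \<le> h i"
  using h_pos by (auto simp: \<delta>_def)

definition At where "At = (\<Sum>i\<in>UNIV. A i)"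
definition Ct where "Ct = (\<Sum>i\<in>UNIV. C i)"

lemma At_nonneg: "nonneg_mat At" and Ct_nonneg: "nonneg_mat Ct"
  by (auto simp: At_def Ct_def A_nonneg C_nonneg intro: nonneg_mat_sum)

lemma At_mult: "At *v x = (\<Sum>i\<in>UNIV. A i *v x)"
  and Ct_mult: "Ct *v x = (\<Sum>i\<in>UNIV. C i *v x)"
  and mult_At: "s v* At = (\<Sum>i\<in>UNIV. s v* A i)"
  and mult_Ct: "s' v* Ct = (\<Sum>i\<in>UNIV. s' v* C i)"
  by (auto simp: At_def Ct_def sum_matrix_vector_mult vector_matrix_mult_sum)

text \<open>All delays are at least \<open>\<delta>\<close>, so the equation is a well-founded
  recursion and has a pointwise solution for any history \<open>\<phi>\<close> and any forcing
  \<open>w\<close>.\<close>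

lemma trajectory_exists:
  "\<exists>x. (\<forall>t<0. x t = \<phi> t) \<and> (\<forall>t\<ge>0. x t = (\<Sum>i\<in>UNIV. A i *v x (t - h i)) + w t)"
proof -
  have "\<exists>x. \<forall>t. x t = (if t < 0 then \<phi> t else (\<Sum>i\<in>UNIV. A i *v x (t - h i)) + w t)"
  proof (rule dependent_wf_choice[OF wf_delay[OF \<delta>_pos],
        where P = "\<lambda>x t r. r = (if t < 0 then \<phi> t else (\<Sum>i\<in>UNIV. A i *v x (t - h i)) + w t)"])
    fix f g :: "real \<Rightarrow> real^'n" and t r
    assume *: "\<And>s. (s, t) \<in> {(s, t). 0 \<le> t \<and> s \<le> t - \<delta>} \<Longrightarrow> f s = g s"
    have "f (t - h i) = g (t - h i)" if "0 \<le> t" for i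
      using *[of "t - h i"] that \<delta>_le[of i] by auto
    then show "(r = (if t < 0 then \<phi> t else (\<Sum>i\<in>UNIV. A i *v f (t - h i)) + w t)) =
        (r = (if t < 0 then \<phi> t else (\<Sum>i\<in>UNIV. A i *v g (t - h i)) + w t))"
      by simp
  qed auto
  then show ?thesis by (metis not_less)
qed

text \<open>The horizon \<open>T\<close> allows a comparison of responses to inputs that agree only
  up to time \<open>T\<close>.\<close>

lemma trajectory_unique:
  assumes "\<And>t. t < 0 \<Longrightarrow> x t = x' t"
    and "\<And>t. 0 \<le> t \<Longrightarrow> t \<le> T \<Longrightarrow> x t = (\<Sum>i\<in>UNIV. A i *v x (t - h i)) + w t"
    and "\<And>t. 0 \<le> t \<Longrightarrow> t \<le> T \<Longrightarrow> x' t = (\<Sum>i\<in>UNIV. A i *v x' (t - h i)) + w t"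
  shows "t \<le> T \<Longrightarrow> x t = x' t"
proof (induction t rule: delay_induct[OF \<delta>_pos, where ?t0.0 = 0])
  case (2 t)
  have "x (t - h i) = x' (t - h i)" for i
    using 2(2)[of "t - h i"] 2(1,3) \<delta>_le[of i] h_pos[of i] by auto
  then show ?case using assms(2,3)[of t] 2 by simp
qed (use assms in auto)

text \<open>Stability rules out the other case of the alternative: a constant history
  \<open>v\<close> with \<open>v \<le> At *v v\<close> keeps its trajectory above \<open>v\<close>
  by monotonicity, while the trajectory tends to 0.\<close>

lemma asym_stable_imp:
  assumes "asym_stable A h"
  shows "\<exists>s. vlt 0 s \<and> vlt (s v* At) s"
proof (rule nonneg_mat_alternative[OF At_nonneg])
  fix v :: "real^'n" assume v: "0 \<le> v" "v \<le> At *v v"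
  obtain x where x: "\<And>t. t < 0 \<Longrightarrow> x t = v" "\<And>t. 0 \<le> t \<Longrightarrow> x t = (\<Sum>i\<in>UNIV. A i *v x (t - h i)) + 0"
    using trajectory_exists[of "\<lambda>_. v" "\<lambda>_. 0"] by blast
  have "bounded (x ` {- Max (range h)..<0})"
    by (rule bounded_subset[of "{v}"]) (auto simp: x)
  then have lim: "(x \<longlongrightarrow> 0) at_top" using assms x unfolding asym_stable_def by simp
  have "v \<le> x t" for t
  proof (induction t rule: delay_induct[OF \<delta>_pos, where ?t0.0 = 0])
    case (2 t)
    have "A i *v v \<le> A i *v x (t - h i)" for i
      using 2(2)[of "t - h i"] \<delta>_le[of i] nonneg_mat_mono[OF A_nonneg] by simp
    then have "At *v v \<le> x t" unfolding At_mult x(2)[OF 2(1)] by (simp add: sum_mono)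
    then show ?case using v(2) by (rule order_trans[rotated])
  qed (simp add: x)
  then have "v $ j \<le> 0" for j
    by (intro tendsto_lowerbound[OF tendsto_vec_nth[OF lim, of j, simplified]])
      (auto simp: less_eq_vec_def)
  then show "v = 0" using v(1) by (auto simp: vec_eq_iff less_eq_vec_def intro: antisym)
qed

text \<open>If one window of length \<open>Max (range h)\<close> lies in the box given by
  \<open>c *\<^sub>R m\<close>, everything after it lies in the box shrunk by \<open>l\<close>. As
  \<open>l \<le> 1\<close>, the small box is inside the large one, so delayed times before and after
  \<open>T0\<close> obey the same bound.\<close>

lemma abs_trajectory_contract:
  assumes m: "vlt 0 m" and l: "0 \<le> l" "l \<le> 1" "At *v m \<le> l *\<^sub>R m" and c: "0 \<le> c"
    and x: "\<And>t. T0 \<le> t \<Longrightarrow> x t = (\<Sum>i\<in>UNIV. A i *v x (t - h i))"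
    and init: "\<And>t. T0 - Max (range h) \<le> t \<Longrightarrow> t < T0 \<Longrightarrow> \<bar>x t\<bar> \<le> c *\<^sub>R m"
    and t: "T0 \<le> t"
  shows "\<bar>x t\<bar> \<le> (l * c) *\<^sub>R m"
proof -
  have m0: "0 \<le> m" using m by (rule vlt_imp_le)
  have "T0 \<le> t \<Longrightarrow> \<bar>x t\<bar> \<le> (l * c) *\<^sub>R m"
  proof (induction t rule: delay_induct[OF \<delta>_pos, where ?t0.0 = T0])
    case (2 t)
    have "\<bar>x (t - h i)\<bar> \<le> c *\<^sub>R m" for i
    proof (cases "t - h i < T0")
      case True
      have "h i \<le> Max (range h)" by simp
      then show ?thesis using init[of "t - h i"] True 2(1) by linarith
    next
      case False
      then have "\<bar>x (t - h i)\<bar> \<le> (l * c) *\<^sub>R m" using 2(2)[of "t - h i"] \<delta>_le[of i] by simp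
      also have "\<dots> \<le> c *\<^sub>R m"
        using l c by (intro scaleR_right_mono m0) (simp add: mult_left_le_one_le)
      finally show ?thesis .
    qed
    then have "\<bar>A i *v x (t - h i)\<bar> \<le> A i *v (c *\<^sub>R m)" for i
      using abs_matrix_vector_mult_le[OF A_nonneg] nonneg_mat_mono[OF A_nonneg] order_trans by blast
    then have "\<bar>x t\<bar> \<le> (\<Sum>i\<in>UNIV. A i *v (c *\<^sub>R m))"
      unfolding x[OF 2(1)] by (intro order_trans[OF sum_abs] sum_mono)
    also have "\<dots> = c *\<^sub>R (At *v m)" by (simp add: At_mult matrix_vector_mult_scaleR scaleR_sum_right)
    also have "\<dots> \<le> c *\<^sub>R (l *\<^sub>R m)" by (rule scaleR_left_mono[OF l(3) c])
    finally show ?case by (simp add: mult.commute)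
  qed simp
  then show ?thesis using t .
qed

lemma asym_stable_if:
  assumes m: "vlt 0 m" "vlt (At *v m) m"
  shows "asym_stable A h"
  unfolding asym_stable_def
proof (intro allI impI, elim conjE)
  fix x :: "real \<Rightarrow> real^'n"
  assume bd: "bounded (x ` {- Max (range h)..<0})"
    and x: "\<forall>t\<ge>0. x t = (\<Sum>i\<in>UNIV. A i *v x (t - h i))"
  have mp: "0 < m $ i" for i using m(1) by (simp add: vlt_def)
  have m0: "0 \<le> m" using m(1) by (rule vlt_imp_le)
  \<comment> \<open>The norm of \<open>At\<close> in the maximum norm weighted by \<open>m\<close>;
    it is below 1 because a finite maximum of ratios below 1 is.\<close>
  define l where "l = Max (range (\<lambda>i. (At *v m) $ i / m $ i))"
  have lge: "(At *v m) $ i / m $ i \<le> l" for i unfolding l_def by simp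
  have l1: "l < 1" unfolding l_def using m(2) mp by (simp add: vlt_def)
  have l0: "0 \<le> l"
    using lge[of undefined] mp[of undefined] nonneg_mat_mult_nonneg[OF At_nonneg m0]
    by (auto simp: less_eq_vec_def intro: order_trans[OF divide_nonneg_pos])
  have lm: "At *v m \<le> l *\<^sub>R m"
    using lge mp by (auto simp: less_eq_vec_def divide_le_eq)
  obtain B where B: "\<And>t. - Max (range h) \<le> t \<Longrightarrow> t < 0 \<Longrightarrow> norm (x t) \<le> B"
    using bd unfolding bounded_iff by (metis atLeastLessThan_iff image_eqI)
  obtain e where e: "e > 0" "\<And>i. e \<le> m $ i" using finite_pos_lower_bound[of "\<lambda>i. m $ i", OF mp] by blast
  \<comment> \<open>Every entry of \<open>m\<close> is at least \<open>e\<close>, so the bounded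
    history fits into the box given by \<open>K *\<^sub>R m\<close>.\<close>
  define K where "K = \<bar>B\<bar> / e"
  have K0: "0 \<le> K" using e by (simp add: K_def)
  have init: "\<bar>x t\<bar> \<le> K *\<^sub>R m" if t: "- Max (range h) \<le> t" "t < 0" for t
  proof -
    have "\<bar>x t $ j\<bar> \<le> K * m $ j" for j
    proof -
      have "\<bar>x t $ j\<bar> \<le> \<bar>B\<bar>" using component_le_norm_cart[of "x t" j] B[OF t] by linarith
      also have "\<dots> = K * e" using e by (simp add: K_def)
      also have "\<dots> \<le> K * m $ j" using e K0 by (intro mult_left_mono)
      finally show ?thesis .
    qed
    then show ?thesis by (simp add: less_eq_vec_def abs_vec_def)
  qed
  define H where "H = Max (range h)"
  have H: "0 < H" unfolding H_def by (rule less_le_trans[OF h_pos[of undefined]]) simp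
  \<comment> \<open>The threshold lies one window before \<open>real k * H\<close>: the bound for
    \<open>k\<close> must hold on the whole window that serves as history for step
    \<open>k + 1\<close>. For \<open>k = 0\<close> this window is the initial function
    itself.\<close>
  have decay: "\<bar>x t\<bar> \<le> (l ^ k * K) *\<^sub>R m" if "real k * H - H \<le> t" for k t
    using that
  proof (induction k arbitrary: t)
    case 0
    show ?case
    proof (cases "t < 0")
      case True
      then show ?thesis using init[of t] 0 by (simp add: H_def)
    next
      case False
      have "\<bar>x t\<bar> \<le> (l * K) *\<^sub>R m"
        by (rule abs_trajectory_contract[OF m(1) l0 _ lm K0, where ?T0.0 = 0]) (use False l1 init x in auto)
      also have "\<dots> \<le> (l ^ 0 * K) *\<^sub>R m"
        using l0 l1 K0 by (intro scaleR_right_mono m0) (simp add: mult_left_le_one_le)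
      finally show ?thesis .
    qed
  next
    case (Suc k)
    have "\<bar>x t\<bar> \<le> (l * (l ^ k * K)) *\<^sub>R m"
    proof (rule abs_trajectory_contract[OF m(1) l0 _ lm, where ?T0.0 = "real k * H"])
      show "0 \<le> l ^ k * K" using l0 K0 by simp
      show "x t = (\<Sum>i\<in>UNIV. A i *v x (t - h i))" if "real k * H \<le> t" for t
        using x that H by (meson mult_nonneg_nonneg of_nat_0_le_iff order.strict_implies_order order_trans)
      show "real k * H \<le> t" using Suc.prems by (simp add: algebra_simps)
      show "\<bar>x t\<bar> \<le> (l ^ k * K) *\<^sub>R m" if "real k * H - Max (range h) \<le> t" for t
        using Suc.IH that by (simp add: H_def)
    qed (use l1 in auto)
    then show ?case by (simp add: mult.assoc)
  qed
  show "(x \<longlongrightarrow> 0) at_top"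
  proof (rule vec_tendstoI)
    fix j
    show "((\<lambda>t. x t $ j) \<longlongrightarrow> 0 $ j) at_top"
    proof (rule tendstoI)
      fix \<epsilon> :: real assume \<epsilon>: "\<epsilon> > 0"
      have "(\<lambda>k. l ^ k * K * m $ j) \<longlonglongrightarrow> 0 * K * m $ j"
        using l0 l1 by (intro tendsto_intros LIMSEQ_realpow_zero) auto
      then have "\<forall>\<^sub>F k in sequentially. l ^ k * K * m $ j < \<epsilon>"
        using \<epsilon> by (simp add: order_tendstoD)
      then obtain k where k: "l ^ k * K * m $ j < \<epsilon>"
        using eventually_happens by force
      have "\<bar>x t $ j\<bar> < \<epsilon>" if "real k * H - H \<le> t" for t
      proof -
        have "\<bar>x t $ j\<bar> \<le> l ^ k * K * m $ j"
          using decay[OF that] by (auto simp: less_eq_vec_def abs_vec_def)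
        then show ?thesis using k by linarith
      qed
      then show "\<forall>\<^sub>F t in at_top. dist (x t $ j) (0 $ j) < \<epsilon>"
        by (auto simp: eventually_at_top_linorder)
    qed
  qed
qed

end

subsection \<open>Dissipation inequalities for delay equations\<close>

lemma nn_integral_shift_lessThan:
  fixes f :: "real \<Rightarrow> ennreal"
  assumes [measurable]: "f \<in> borel_measurable borel"
  shows "(\<integral>\<^sup>+t. f (t - d) * indicator {..<T} t \<partial>lborel) = (\<integral>\<^sup>+t. f t * indicator {..<T - d} t \<partial>lborel)"
  by (subst (2) nn_integral_real_affine[where c = 1 and t = "- d"])
    (auto intro!: nn_integral_cong simp: indicator_def)

text \<open>Here \<open>f i\<close> are storage functions, \<open>a\<close> is the output density
  and \<open>c * b\<close> the supply. Integrated up to \<open>T\<close>, the delayed storage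
  becomes \<open>F i (T - h i)\<close>, because \<open>f i\<close> vanishes before 0, and this is at
  most \<open>F i T\<close>. After cancellation only the integrals of \<open>a\<close> and of
  \<open>c * b\<close> remain, and \<open>T\<close> can tend to infinity.\<close>

lemma dissipation_inequality:
  fixes f :: "'i::finite \<Rightarrow> real \<Rightarrow> real" and a b :: "real \<Rightarrow> real"
  assumes h: "\<And>i. 0 < h i"
    and meas [measurable]: "\<And>i. f i \<in> borel_measurable borel"
      "a \<in> borel_measurable borel" "b \<in> borel_measurable borel"
    and nonneg: "\<And>i t. 0 \<le> f i t" "\<And>t. 0 \<le> a t" "\<And>t. 0 \<le> b t" "0 \<le> c"
    and zero: "\<And>i t. t < 0 \<Longrightarrow> f i t = 0"
    and diss: "\<And>t. 0 \<le> t \<Longrightarrow> a t + (\<Sum>i\<in>UNIV. f i t) \<le> (\<Sum>i\<in>UNIV. f i (t - h i)) + c * b t"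
    and b: "set_integrable lborel {0..} b"
  shows "set_integrable lborel {0..} a"
    and "(LINT t:{0..}|lborel. a t) \<le> c * (LINT t:{0..}|lborel. b t)"
proof -
  define F where "F i T = (\<integral>\<^sup>+t. ennreal (f i t) * indicator {..<T} t \<partial>lborel)" for i T
  define B where "B = (LINT t:{0..}|lborel. b t)"
  have B0: "0 \<le> B" unfolding B_def set_lebesgue_integral_def
    using nonneg by (intro integral_nonneg_AE) (auto simp: indicator_def)
  have B: "(\<integral>\<^sup>+t. ennreal (c * b t) * indicator {0..} t \<partial>lborel) = ennreal (c * B)"
  proof -
    have "(\<integral>\<^sup>+t. ennreal (c * b t) * indicator {0..} t \<partial>lborel)
        = (\<integral>\<^sup>+t. ennreal (c * (indicator {0..} t *\<^sub>R b t)) \<partial>lborel)"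
      by (intro nn_integral_cong) (auto simp: indicator_def)
    also have "\<dots> = ennreal (\<integral>t. c * (indicator {0..} t *\<^sub>R b t) \<partial>lborel)"
      using b nonneg unfolding set_integrable_def
      by (intro nn_integral_eq_integral integrable_mult_right) (auto simp: indicator_def)
    finally show ?thesis by (simp add: B_def set_lebesgue_integral_def)
  qed
  have F_mono: "F i T \<le> F i T'" if "T \<le> T'" for i T T'
    unfolding F_def using that by (intro nn_integral_mono) (auto simp: indicator_def)
  \<comment> \<open>Extended nonnegative integrals allow integration of the pointwise inequality
    before anything is known about integrability of \<open>f i\<close> or \<open>a\<close>.\<close>
  have key: "(\<integral>\<^sup>+t. ennreal (a t) * indicator {0..<T} t \<partial>lborel) + (\<Sum>i\<in>UNIV. F i T)
      \<le> (\<Sum>i\<in>UNIV. F i (T - h i)) + ennreal (c * B)" for T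
  proof -
    have "(\<integral>\<^sup>+t. ennreal (a t) * indicator {0..<T} t \<partial>lborel) + (\<Sum>i\<in>UNIV. F i T)
       = (\<integral>\<^sup>+t. ennreal (a t) * indicator {0..<T} t + (\<Sum>i\<in>UNIV. ennreal (f i t) * indicator {..<T} t) \<partial>lborel)"
      unfolding F_def by (subst nn_integral_add, simp, simp, subst nn_integral_sum) simp_all
    also have "\<dots> \<le> (\<integral>\<^sup>+t. (\<Sum>i\<in>UNIV. ennreal (f i (t - h i)) * indicator {..<T} t)
        + ennreal (c * b t) * indicator {0..} t \<partial>lborel)"
    proof (rule nn_integral_mono)
      fix t :: real
      consider "t < 0" | "0 \<le> t" "t < T" | "T \<le> t" "0 \<le> t" by linarith
      then show "ennreal (a t) * indicator {0..<T} t + (\<Sum>i\<in>UNIV. ennreal (f i t) * indicator {..<T} t)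
        \<le> (\<Sum>i\<in>UNIV. ennreal (f i (t - h i)) * indicator {..<T} t) + ennreal (c * b t) * indicator {0..} t"
      proof cases
        case 2
        have "ennreal (a t + (\<Sum>i\<in>UNIV. f i t)) \<le> ennreal ((\<Sum>i\<in>UNIV. f i (t - h i)) + c * b t)"
          using diss[OF 2(1)] by (rule ennreal_leI)
        then show ?thesis using 2 nonneg
          by (simp add: ennreal_plus sum_nonneg sum_ennreal del: ennreal_plus[symmetric])
      qed (simp_all add: zero)
    qed
    also have "\<dots> = (\<Sum>i\<in>UNIV. F i (T - h i)) + ennreal (c * B)"
      unfolding F_def B[symmetric]
      by (subst nn_integral_add, simp, simp, subst nn_integral_sum)
        (simp_all add: nn_integral_shift_lessThan[of "\<lambda>t. ennreal (f _ t)"])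
    finally show ?thesis .
  qed
  define d where "d = Min (range h)"
  have d: "0 < d" "\<And>i. d \<le> h i" using h by (auto simp: d_def)
  \<comment> \<open>Cancelling \<open>F i T\<close> requires it to be finite. It is 0 for negative
    \<open>T\<close>, and \<open>key\<close> bounds it by values at earlier times, so the method of
    steps applies.\<close>
  have fin: "F i T < \<infinity>" for i T
  proof (induction T arbitrary: i rule: delay_induct[OF d(1), where ?t0.0 = 0])
    case (1 T)
    have "F i T = (\<integral>\<^sup>+t. 0 \<partial>(lborel :: real measure))"
      unfolding F_def using 1 by (intro nn_integral_cong) (auto simp: zero indicator_def)
    then show ?case by simp
  next
    case (2 T)
    have "F i T \<le> (\<Sum>i\<in>UNIV. F i T)" by (intro member_le_sum) auto
    also have "\<dots> \<le> (\<integral>\<^sup>+t. ennreal (a t) * indicator {0..<T} t \<partial>lborel) + (\<Sum>i\<in>UNIV. F i T)"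
      by simp
    also note key
    also have "(\<Sum>i\<in>UNIV. F i (T - h i)) + ennreal (c * B) < \<infinity>"
      using 2(2) d(2) by simp
    finally show ?case .
  qed
  have bound: "(\<integral>\<^sup>+t. ennreal (a t) * indicator {0..<T} t \<partial>lborel) \<le> ennreal (c * B)" for T
  proof -
    have "(\<Sum>i\<in>UNIV. F i T) + (\<integral>\<^sup>+t. ennreal (a t) * indicator {0..<T} t \<partial>lborel)
        \<le> (\<Sum>i\<in>UNIV. F i (T - h i)) + ennreal (c * B)"
      using key[of T] by (simp add: add.commute)
    also have "\<dots> \<le> (\<Sum>i\<in>UNIV. F i T) + ennreal (c * B)"
      using h by (intro add_right_mono sum_mono F_mono) (simp add: less_imp_le)
    finally have "(\<Sum>i\<in>UNIV. F i T) + (\<integral>\<^sup>+t. ennreal (a t) * indicator {0..<T} t \<partial>lborel)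
        \<le> (\<Sum>i\<in>UNIV. F i T) + ennreal (c * B)" .
    moreover have "(\<Sum>i\<in>UNIV. F i T) \<noteq> \<infinity>" using fin[of _ T] by (simp add: less_top[symmetric])
    ultimately show ?thesis by (simp only: ennreal_add_left_cancel_le) simp
  qed
  \<comment> \<open>Monotone convergence along integer horizons, as the bound \<open>c * B\<close>
    does not depend on \<open>T\<close>.\<close>
  have "(\<integral>\<^sup>+t. ennreal (a t) * indicator {0..} t \<partial>lborel)
      = (\<integral>\<^sup>+t. (SUP n. ennreal (a t) * indicator {0..<real n} t) \<partial>lborel)"
  proof (rule nn_integral_cong)
    fix t :: real
    obtain n where n: "t < real n" using reals_Archimedean2 by blast
    show "ennreal (a t) * indicator {0..} t = (SUP n. ennreal (a t) * indicator {0..<real n} t)"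
    proof (rule antisym)
      show "ennreal (a t) * indicator {0..} t \<le> (SUP n. ennreal (a t) * indicator {0..<real n} t)"
        by (rule SUP_upper2[of n]) (use n in \<open>auto simp: indicator_def\<close>)
    qed (auto intro!: SUP_least simp: indicator_def)
  qed
  also have "\<dots> = (SUP n. \<integral>\<^sup>+t. ennreal (a t) * indicator {0..<real n} t \<partial>lborel)"
    by (rule nn_integral_monotone_convergence_SUP)
      (auto simp: incseq_def le_fun_def indicator_def)
  also have "\<dots> \<le> ennreal (c * B)" using bound by (intro SUP_least)
  finally have total: "(\<integral>\<^sup>+t. ennreal (indicator {0..} t *\<^sub>R a t) \<partial>lborel) \<le> ennreal (c * B)"
    by (simp add: indicator_mult_ennreal[symmetric] mult.commute[of _ "indicator _ _"])
  show int: "set_integrable lborel {0..} a"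
    unfolding set_integrable_def
  proof (rule integrableI_nonneg)
    show "(\<integral>\<^sup>+t. ennreal (indicator {0..} t *\<^sub>R a t) \<partial>lborel) < \<infinity>"
      using total by (auto simp: le_less_trans[OF _ ennreal_less_top])
  qed (use nonneg in \<open>auto simp: indicator_def\<close>)
  have "(\<integral>\<^sup>+t. ennreal (indicator {0..} t *\<^sub>R a t) \<partial>lborel) = ennreal (LINT t:{0..}|lborel. a t)"
    using int nonneg unfolding set_integrable_def set_lebesgue_integral_def
    by (intro nn_integral_eq_integral) (auto simp: indicator_def)
  then show "(LINT t:{0..}|lborel. a t) \<le> c * (LINT t:{0..}|lborel. b t)"
    using total nonneg(4) B0 by (simp add: B_def)
qed

text \<open>The means of \<open>f\<close> over \<open>{0..T}\<close> are at most \<open>K\<close>.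
  If the limit were larger, \<open>f\<close> would exceed some \<open>L' > K\<close> from a time
  \<open>S\<close> on, and \<open>L' * (T - S)\<close> would outgrow \<open>K * T\<close>.\<close>

lemma tendsto_le_of_integral_le:
  fixes f :: "real \<Rightarrow> real"
  assumes lim: "(f \<longlongrightarrow> L) at_top" and nonneg: "\<And>t. 0 \<le> t \<Longrightarrow> 0 \<le> f t"
    and int: "\<And>T. 0 \<le> T \<Longrightarrow> set_integrable lborel {0..T} f"
    and le: "\<And>T. 0 \<le> T \<Longrightarrow> (LINT t:{0..T}|lborel. f t) \<le> K * T"
  shows "L \<le> K"
proof (rule ccontr)
  assume "\<not> L \<le> K"
  define L' where "L' = (K + L) / 2"
  have L': "K < L'" "L' < L" using \<open>\<not> L \<le> K\<close> by (auto simp: L'_def)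
  obtain T0 where T0: "\<And>t. T0 \<le> t \<Longrightarrow> L' < f t"
    using order_tendstoD(1)[OF lim L'(2)] by (auto simp: eventually_at_top_linorder)
  define S where "S = max T0 0"
  have le': "L' * (T - S) \<le> K * T" if T: "S \<le> T" for T
  proof -
    have "L' * (T - S) = (LINT t:{S..T}|lborel. L')"
      using T by (simp add: set_lebesgue_integral_def measure_def)
    also have "\<dots> = (LINT t|lborel. indicator {S..T} t *\<^sub>R L')"
      by (simp add: set_lebesgue_integral_def)
    also have "\<dots> \<le> (LINT t|lborel. indicator {0..T} t *\<^sub>R f t)"
    proof (rule integral_mono)
      show "integrable lborel (\<lambda>t. indicator {S..T} t *\<^sub>R L')" using T by simp
      show "integrable lborel (\<lambda>t. indicator {0..T} t *\<^sub>R f t)"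
        using int[of T] T by (simp add: set_integrable_def S_def)
      show "indicator {S..T} t *\<^sub>R L' \<le> indicator {0..T} t *\<^sub>R f t" for t
        using T0[of t] nonneg[of t] by (auto simp: indicator_def S_def)
    qed
    also have "\<dots> = (LINT t:{0..T}|lborel. f t)" by (simp add: set_lebesgue_integral_def)
    also have "\<dots> \<le> K * T" using le T by (simp add: S_def)
    finally show ?thesis .
  qed
  have "0 \<le> (LINT t:{0..1}|lborel. f t)" unfolding set_lebesgue_integral_def
    using nonneg by (intro integral_nonneg_AE) (auto simp: indicator_def)
  then have K: "0 \<le> K" using le[of 1] by simp
  \<comment> \<open>Chosen so that \<open>(L' - K) * T\<close> exceeds \<open>L' * S\<close>, the
    loss from the initial interval, by \<open>(L' - K) * (S + 1)\<close>. That \<open>T\<close> is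
    at least \<open>S\<close> rests on \<open>K\<close> being nonnegative.\<close>
  define T where "T = S + 1 + L' * S / (L' - K)"
  have S0: "0 \<le> S" by (simp add: S_def)
  have "S \<le> T" using K L' S0 by (simp add: T_def)
  moreover have "(L' - K) * T = L' * S + (L' - K) * (S + 1)"
    using L' by (simp add: T_def field_simps)
  moreover have "0 < (L' - K) * (S + 1)" using L' S0 by simp
  ultimately show False using le'[of T] by (simp add: algebra_simps)
qed

section \<open>Measurability of norms and matrix maps\<close>

lemma continuous_on_norm1: "continuous_on UNIV (norm1 :: real^'a \<Rightarrow> real)"
  unfolding norm1_def by (intro continuous_intros)

lemma norm1_nonneg: "0 \<le> norm1 v"
  by (simp add: norm1_def sum_nonneg)

lemma norm1_eq_inner: "norm1 v = 1 \<bullet> \<bar>v\<bar>"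
  by (simp add: norm1_def inner_vec_def abs_vec_def)

lemma norminf_le_iff: "norminf v \<le> c \<longleftrightarrow> (\<forall>i. \<bar>v $ i\<bar> \<le> c)"
  by (auto simp: norminf_def)

lemma norminf_nonneg: "0 \<le> norminf v"
  using norminf_le_iff[of v "norminf v"] abs_ge_zero order_trans by blast

lemma borel_measurable_norminf [measurable]: "(norminf :: real^'a \<Rightarrow> real) \<in> borel_measurable borel"
proof (rule borel_measurable_iff_le[THEN iffD2], safe)
  fix a :: real
  have "closed {v :: real^'a. norminf v \<le> a}"
    unfolding norminf_le_iff by (intro closed_Collect_all closed_Collect_le continuous_intros)
  then show "{v \<in> space borel. norminf (v :: real^'a) \<le> a} \<in> sets borel" by simp
qed

lemma borel_measurable_norm1 [measurable]: "(norm1 :: real^'a \<Rightarrow> real) \<in> borel_measurable borel"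
  by (intro borel_measurable_continuous_onI continuous_on_norm1)

lemma borel_measurable_matrix_vector_mult [measurable]:
  fixes M :: "real^'c^'r"
  shows "(\<lambda>x. M *v x) \<in> borel_measurable borel"
  by (intro borel_measurable_continuous_onI linear_continuous_on matrix_vector_mul_bounded_linear)

section \<open>Measurable trajectories and the static gain\<close>

context positive_delay_system
begin

text \<open>A trajectory is only given pointwise, so its measurability has to be derived. The
  truncation \<open>X (Suc k)\<close> depends on the input and on shifts of \<open>X k\<close>
  alone, and the truncations converge pointwise to \<open>x\<close>.\<close>

lemma trajectory_measurable:
  assumes u: "u \<in> borel_measurable borel" and x0: "\<And>t. t < 0 \<Longrightarrow> x t = 0"
    and x: "is_traj A Eu h u x"
  shows "x \<in> borel_measurable borel"
proof -
  note [measurable] = u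
  define X where "X k t = (if t < real k * \<delta> then x t else 0)" for k t
  have "X k \<in> borel_measurable borel" for k
  proof (induction k)
    case 0
    have "X 0 = (\<lambda>_. 0)" using x0 by (auto simp: X_def)
    then show ?case by simp
  next
    case (Suc k)
    note [measurable] = Suc
    have "x t = (\<Sum>i\<in>UNIV. A i *v X k (t - h i)) + Eu *v u t"
      if t: "0 \<le> t" "t < real (Suc k) * \<delta>" for t
    proof -
      have "X k (t - h i) = x (t - h i)" for i
        using t \<delta>_le[of i] by (simp add: X_def algebra_simps)
      then show ?thesis using x t by (simp add: is_traj_def)
    qed
    then have "X (Suc k) = (\<lambda>t. if 0 \<le> t \<and> t < real (Suc k) * \<delta>
        then (\<Sum>i\<in>UNIV. A i *v X k (t - h i)) + Eu *v u t else 0)"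
      using x0 by (auto simp: X_def fun_eq_iff)
    also have "\<dots> \<in> borel_measurable borel" by measurable
    finally show ?case .
  qed
  moreover have "(\<lambda>k. X k t) \<longlonglongrightarrow> x t" for t
  proof (rule tendsto_eventually)
    obtain k where "t / \<delta> < real k" using reals_Archimedean2 by blast
    then have "t < real k * \<delta>" using \<delta>_pos by (simp add: field_simps)
    then have "X n t = x t" if "k \<le> n" for n
      using that \<delta>_pos less_le_trans[of t "real k * \<delta>" "real n * \<delta>"] by (simp add: X_def)
    then show "\<forall>\<^sub>F k in sequentially. X k t = x t" by (auto simp: eventually_sequentially)
  qed
  ultimately show ?thesis by (rule borel_measurable_LIMSEQ_metric)
qed

lemma sys_output_measurable:
  assumes [measurable]: "u \<in> borel_measurable borel" "x \<in> borel_measurable borel"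
  shows "sys_output C Fu h u x \<in> borel_measurable borel"
  unfolding sys_output_def by measurable

text \<open>The transfer matrix at frequency zero. The resolvent is a parameter, so that the matrix
  can be written down before invertibility of \<open>mat 1 - At\<close> is known.\<close>

definition dcgain where "dcgain R = Ct ** R ** Eu + Fu"

lemma dcgain_mult: "dcgain R *v v = Ct *v (R *v (Eu *v v)) + Fu *v v"
  by (simp add: dcgain_def matrix_vector_mul_assoc matrix_vector_mult_add_rdistrib matrix_mul_assoc)

lemma mult_dcgain: "w v* dcgain R = ((w v* Ct) v* R) v* Eu + w v* Fu"
  by (simp add: dcgain_def vector_matrix_mul_assoc vector_matrix_mult_add_rdistrib matrix_mul_assoc)

text \<open>The deviation from the equilibrium \<open>m\<close> obeys the unforced equation, and its
  history is the constant \<open>m\<close> because \<open>x\<close> vanishes before 0; hence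
  stability applies to it.\<close>

lemma step_response:
  assumes stable: "asym_stable A h" and R: "(mat 1 - At) ** R = mat 1"
    and x0: "\<And>t. t < 0 \<Longrightarrow> x t = 0" and x: "is_traj A Eu h (\<lambda>_. v) x"
  shows "(sys_output C Fu h (\<lambda>_. v) x \<longlongrightarrow> dcgain R *v v) at_top"
proof -
  define m where "m = R *v (Eu *v v)"
  have "(mat 1 - At) *v m = Eu *v v" by (simp add: m_def R matrix_vector_mul_assoc matrix_mul_assoc)
  then have m: "m = At *v m + Eu *v v" by (simp add: matrix_vector_mult_diff_rdistrib algebra_simps)
  define e where "e t = m - x t" for t
  have "e t = (\<Sum>i\<in>UNIV. A i *v e (t - h i))" if "0 \<le> t" for t
  proof -
    have "e t = At *v m - (\<Sum>i\<in>UNIV. A i *v x (t - h i))"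
      unfolding e_def by (subst m) (use x that in \<open>simp add: is_traj_def\<close>)
    also have "\<dots> = (\<Sum>i\<in>UNIV. A i *v e (t - h i))"
      by (simp add: e_def At_mult matrix_vector_mult_diff_distrib sum_subtractf)
    finally show ?thesis .
  qed
  moreover have "bounded (e ` {- Max (range h)..<0})"
    by (rule bounded_subset[of "{m}"]) (auto simp: e_def x0)
  ultimately have "(e \<longlongrightarrow> 0) at_top" using stable unfolding asym_stable_def by blast
  then have "((\<lambda>t. m - e t) \<longlongrightarrow> m - 0) at_top" by (intro tendsto_intros)
  then have xm: "(x \<longlongrightarrow> m) at_top" by (simp add: e_def)
  have "((\<lambda>t. x (t - h i)) \<longlongrightarrow> m) at_top" for i
  proof (rule filterlim_compose[OF xm])
    show "LIM t at_top. t - h i :> at_top"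
      using filterlim_tendsto_add_at_top[OF tendsto_const[of "- h i"] filterlim_ident] by simp
  qed
  then have "((\<lambda>t. (\<Sum>i\<in>UNIV. C i *v x (t - h i)) + Fu *v v) \<longlongrightarrow> (\<Sum>i\<in>UNIV. C i *v m) + Fu *v v) at_top"
    by (intro tendsto_intros bounded_linear.tendsto[OF matrix_vector_mul_bounded_linear])
  then show ?thesis by (simp add: sys_output_def[abs_def] dcgain_mult m_def[symmetric] Ct_mult)
qed

text \<open>Serves both \<open>p = 1\<close> and \<open>p = 2\<close>, with \<open>\<Phi>\<close>
  and \<open>\<Psi>\<close> the integrands of the norms. A constant input has infinite cost in
  general, so it is cut off at \<open>T\<close>. By causality the output is unchanged on
  \<open>{0..T}\<close>, its cost there is at most \<open>c * \<Psi> v * T\<close>, and the time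
  average passes to the limit of the step response.\<close>

lemma integral_gain_lower_bound:
  fixes \<Phi> :: "real^'y \<Rightarrow> real" and \<Psi> :: "real^'u \<Rightarrow> real"
  assumes stable: "asym_stable A h" and R: "(mat 1 - At) ** R = mat 1"
    and \<Phi>: "continuous_on UNIV \<Phi>" "\<And>y. 0 \<le> \<Phi> y" and \<Psi>: "\<Psi> 0 = 0"
    and gain: "\<And>u x. u \<in> borel_measurable borel \<Longrightarrow> set_integrable lborel {0..} (\<lambda>t. \<Psi> (u t)) \<Longrightarrow>
        (\<forall>t<0. x t = 0) \<Longrightarrow> is_traj A Eu h u x \<Longrightarrow>
        set_integrable lborel {0..} (\<lambda>t. \<Phi> (sys_output C Fu h u x t)) \<and>
        (LINT t:{0..}|lborel. \<Phi> (sys_output C Fu h u x t)) \<le> c * (LINT t:{0..}|lborel. \<Psi> (u t))"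
  shows "\<Phi> (dcgain R *v v) \<le> c * \<Psi> v"
proof -
  obtain x where x0: "\<forall>t<0. x t = 0" and x: "is_traj A Eu h (\<lambda>_. v) x"
    using trajectory_exists[of "\<lambda>_. 0" "\<lambda>_. Eu *v v"] unfolding is_traj_def by blast
  define y where "y = sys_output C Fu h (\<lambda>_. v) x"
  have lim: "((\<lambda>t. \<Phi> (y t)) \<longlongrightarrow> \<Phi> (dcgain R *v v)) at_top"
    unfolding y_def using step_response[OF stable R _ x] x0 \<Phi>(1)
    by (intro continuous_on_tendsto_compose[OF \<Phi>(1)]) auto
  have trunc: "set_integrable lborel {0..T} (\<lambda>t. \<Phi> (y t)) \<and>
      (LINT t:{0..T}|lborel. \<Phi> (y t)) \<le> c * \<Psi> v * T" if T: "0 \<le> T" for T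
  proof -
    define u where "u t = (if 0 \<le> t \<and> t \<le> T then v else 0)" for t :: real
    obtain z where z0: "\<forall>t<0. z t = 0" and z: "is_traj A Eu h u z"
      using trajectory_exists[of "\<lambda>_. 0" "\<lambda>t. Eu *v u t"] unfolding is_traj_def by blast
    have xz: "z t = x t" if "t \<le> T" for t
    proof (rule trajectory_unique[where T = T and w = "\<lambda>_. Eu *v v"])
      show "z t = (\<Sum>i\<in>UNIV. A i *v z (t - h i)) + Eu *v v" if "0 \<le> t" "t \<le> T" for t
        using z that by (simp add: is_traj_def u_def)
    qed (use x x0 z0 that in \<open>auto simp: is_traj_def\<close>)
    have yz: "sys_output C Fu h u z t = y t" if "0 \<le> t" "t \<le> T" for t
      using xz[of "t - h _"] that h_pos less_imp_le[OF h_pos]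
      by (simp add: sys_output_def y_def u_def) (smt (verit, best) h_pos sum.cong)
    \<comment> \<open>Since \<open>\<Psi> 0 = 0\<close>, the input costs nothing after the
      cut-off.\<close>
    have \<Psi>u: "indicator {0..} t *\<^sub>R \<Psi> (u t) = indicator {0..T} t *\<^sub>R \<Psi> v" for t
      by (auto simp: u_def indicator_def \<Psi>)
    have "u \<in> borel_measurable borel" unfolding u_def by measurable
    moreover have "set_integrable lborel {0..} (\<lambda>t. \<Psi> (u t))"
      unfolding set_integrable_def \<Psi>u
      by (intro integrable_scaleR_left impI integrable_real_indicator) (use T in auto)
    ultimately have g: "set_integrable lborel {0..} (\<lambda>t. \<Phi> (sys_output C Fu h u z t))"
        "(LINT t:{0..}|lborel. \<Phi> (sys_output C Fu h u z t)) \<le> c * (LINT t:{0..}|lborel. \<Psi> (u t))"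
      using gain[OF _ _ z0 z] by auto
    have "set_integrable lborel {0..T} (\<lambda>t. \<Phi> (sys_output C Fu h u z t))"
      by (rule set_integrable_subset[OF g(1)]) auto
    moreover have eq: "indicator {0..T} t *\<^sub>R \<Phi> (sys_output C Fu h u z t) = indicator {0..T} t *\<^sub>R \<Phi> (y t)" for t
      by (auto simp: indicator_def yz)
    ultimately have int: "set_integrable lborel {0..T} (\<lambda>t. \<Phi> (y t))"
      unfolding set_integrable_def eq by simp
    have "(LINT t:{0..T}|lborel. \<Phi> (y t)) \<le> (LINT t:{0..}|lborel. \<Phi> (sys_output C Fu h u z t))"
      unfolding set_lebesgue_integral_def
      using int g(1) \<Phi>(2) yz unfolding set_integrable_def
      by (intro integral_mono) (auto simp: indicator_def)
    also have "\<dots> \<le> c * (LINT t:{0..}|lborel. \<Psi> (u t))" by (rule g)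
    also have "(LINT t:{0..}|lborel. \<Psi> (u t)) = \<Psi> v * T"
      unfolding set_lebesgue_integral_def \<Psi>u using T by simp
    finally show ?thesis using int by (simp add: mult.assoc)
  qed
  show ?thesis
    by (rule tendsto_le_of_integral_le[OF lim]) (use \<Phi>(2) trunc in auto)
qed

end

subsection \<open>Block vectors and block matrices\<close>

text \<open>Identifies the stacked space with families of vectors indexed by the delays, so that all
  block identities become sums over \<open>i\<close> without entries.\<close>

definition blockvec :: "('i::finite \<Rightarrow> real^'n) \<Rightarrow> real^('i \<times> 'n)" where
  "blockvec m = (\<chi> p. m (fst p) $ snd p)"

lemma blockvec_surj: "\<exists>m. v = blockvec m"
  by (rule exI[of _ "\<lambda>i. \<chi> n. v $ (i, n)"]) (simp add: blockvec_def vec_eq_iff)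

lemma ex_blockvec: "(\<exists>\<mu>. P \<mu>) \<longleftrightarrow> (\<exists>m. P (blockvec m))"
  using blockvec_surj by metis

lemma vcat_surj: "\<exists>x y. v = vcat x y"
  by (rule exI[of _ "\<chi> i. v $ Inl i"], rule exI[of _ "\<chi> j. v $ Inr j"])
    (auto simp: vcat_def vec_eq_iff split: sum.split)

lemma sum_UNIV_prod: "(\<Sum>p\<in>(UNIV :: ('a::finite \<times> 'b::finite) set). f p) = (\<Sum>i\<in>UNIV. \<Sum>j\<in>UNIV. f (i, j))"
  by (simp add: sum.cartesian_product)

lemma sum_UNIV_sum: "(\<Sum>p\<in>(UNIV :: ('a::finite + 'b::finite) set). f p)
    = (\<Sum>i\<in>UNIV. f (Inl i)) + (\<Sum>j\<in>UNIV. f (Inr j))"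
  by (simp add: UNIV_Plus_UNIV[symmetric] sum.Plus del: UNIV_Plus_UNIV)

lemma blockrow_mult_blockvec: "blockrow M *v blockvec m = (\<Sum>i\<in>UNIV. M i *v m i)"
  by (simp add: vec_eq_iff blockrow_def blockvec_def matrix_vector_mult_def sum_UNIV_prod)

lemma mult_blockrow: "(w :: real^'r) v* blockrow M = blockvec (\<lambda>i. w v* M i)"
  by (simp add: vec_eq_iff blockrow_def blockvec_def vector_matrix_mult_def)

lemma ones_kron_mult: "ones_kron M *v (x :: real^'c) = blockvec (\<lambda>_. M *v x)"
  by (simp add: vec_eq_iff ones_kron_def blockvec_def matrix_vector_mult_def)

lemma blockvec_mult_ones_kron: "blockvec m v* ones_kron M = (\<Sum>i\<in>UNIV. m i) v* M"
  by (simp add: vec_eq_iff ones_kron_def blockvec_def vector_matrix_mult_def sum_UNIV_prod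
      sum_distrib_right) (subst sum.swap, simp)

lemma blockcol_mult: "blockcol M *v (x :: real^'c) = blockvec (\<lambda>i. M i *v x)"
  by (simp add: vec_eq_iff blockcol_def blockvec_def matrix_vector_mult_def)

lemma blockdiag_mult_blockvec: "blockdiag M *v blockvec m = blockvec (\<lambda>i. M i *v m i)"
proof -
  have "(\<Sum>i\<in>UNIV. \<Sum>j\<in>UNIV. (if a = i then M a $ b $ j else 0) * m i $ j) =
      (\<Sum>i\<in>UNIV. if a = i then (\<Sum>j\<in>UNIV. M a $ b $ j * m a $ j) else 0)" for a b
    by (intro sum.cong) auto
  then show ?thesis
    by (simp add: vec_eq_iff blockdiag_def blockvec_def matrix_vector_mult_def sum_UNIV_prod
        cong: if_cong)
qed

lemma inner_blockvec: "blockvec m \<bullet> blockvec m' = (\<Sum>i\<in>UNIV. m i \<bullet> m' i)"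
  by (simp add: blockvec_def inner_vec_def sum_UNIV_prod)

lemma blk_mult_vcat: "blk M11 M12 M21 M22 *v vcat x y = vcat (M11 *v x + M12 *v y) (M21 *v x + M22 *v y)"
  by (auto simp: vec_eq_iff blk_def vcat_def matrix_vector_mult_def sum_UNIV_sum split: sum.split)

lemma vcat_mult_blk: "vcat x y v* blk M11 M12 M21 M22 = vcat (x v* M11 + y v* M21) (x v* M12 + y v* M22)"
  by (auto simp: vec_eq_iff blk_def vcat_def vector_matrix_mult_def sum_UNIV_sum split: sum.split)

lemma inner_vcat: "vcat x y \<bullet> vcat x' y' = x \<bullet> x' + y \<bullet> y'"
  by (simp add: vcat_def inner_vec_def sum_UNIV_sum)

lemma vlt_vcat: "vlt (vcat x y) (vcat x' y') \<longleftrightarrow> vlt x x' \<and> vlt y y'"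
  unfolding vlt_def vcat_def by (auto split: sum.split)

lemma vlt_blockvec: "vlt (blockvec m) (blockvec m') \<longleftrightarrow> (\<forall>i. vlt (m i) (m' i))"
  by (auto simp: vlt_def blockvec_def)

lemma vlt_0_blockvec: "vlt 0 (blockvec m) \<longleftrightarrow> (\<forall>i. vlt 0 (m i))"
  by (auto simp: vlt_def blockvec_def)

lemma blockvec_add: "blockvec m + blockvec m' = blockvec (\<lambda>i. m i + m' i)"
  by (simp add: blockvec_def vec_eq_iff)

lemma vlt_sum:
  fixes x y :: "'i::finite \<Rightarrow> real^'n"
  shows "(\<And>i. vlt (x i) (y i)) \<Longrightarrow> vlt (\<Sum>i\<in>UNIV. x i) (\<Sum>i\<in>UNIV. y i)"
  by (auto simp: vlt_def intro!: sum_strict_mono)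

subsection \<open>The $L_1$-gain\<close>

text \<open>Multiplying a block row vector by the stacked copies sums its blocks, so the stacked
  programme sees \<open>A i\<close> only through \<open>\<Sum>k. m k\<close>.\<close>

lemma L1_lp_blocks:
  "(\<exists>\<mu> :: real^('i::finite \<times> 'n::finite). vlt 0 \<mu> \<and>
      vlt (vcat \<mu> (1 :: real^'y) v* blk (ones_kron (mat 1) ** blockrow A) (ones_kron Eu) (blockrow C) Fu)
          (vcat \<mu> (\<gamma> *\<^sub>R (1 :: real^'u)))) \<longleftrightarrow>
   (\<exists>m. (\<forall>i. vlt 0 (m i)) \<and> (\<forall>i. vlt ((\<Sum>k\<in>UNIV. m k) v* A i + 1 v* C i) (m i)) \<and>
      vlt ((\<Sum>k\<in>UNIV. m k) v* Eu + 1 v* Fu) (\<gamma> *\<^sub>R 1))"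
  by (subst ex_blockvec) (simp add: vcat_mult_blk vector_matrix_mul_assoc[symmetric]
      blockvec_mult_ones_kron mult_blockrow blockvec_add vlt_vcat vlt_blockvec vlt_0_blockvec conj_assoc)

lemma borel_measurable_inner_abs [measurable]:
  fixes m :: "real^'n"
  shows "(\<lambda>v. m \<bullet> \<bar>v\<bar>) \<in> borel_measurable borel"
  unfolding inner_vec_def abs_vec_def
  by (intro borel_measurable_continuous_onI) (auto intro!: continuous_intros)

lemma ones_nonneg: "0 \<le> (1 :: real^'n)"
  by (simp add: less_eq_vec_def)

lemma norm1_axis: "norm1 (axis j 1 :: real^'n) = 1"
  by (simp add: norm1_def axis_def if_distrib cong: if_cong)

context positive_delay_system
begin

lemma asym_stable_resolvent:
  assumes "asym_stable A h"
  obtains R where "nonneg_mat R" "(mat 1 - At) ** R = mat 1" "R ** (mat 1 - At) = mat 1"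
proof -
  obtain s where s: "vlt 0 s" "vlt (s v* At) s" using asym_stable_imp[OF assms] by blast
  obtain m where m: "vlt 0 m" "vlt (At *v m) m" using vlt_left_imp_right[OF At_nonneg s] by blast
  show thesis by (rule resolvent_exists[OF At_nonneg m that])
qed

lemma abs_trajectory_le:
  assumes "is_traj A Eu h u x" "0 \<le> t"
  shows "\<bar>x t\<bar> \<le> (\<Sum>i\<in>UNIV. A i *v \<bar>x (t - h i)\<bar>) + Eu *v \<bar>u t\<bar>"
  using assms
  by (auto simp: is_traj_def intro!: order_trans[OF abs_triangle_ineq] order_trans[OF sum_abs]
      add_mono sum_mono abs_matrix_vector_mult_le A_nonneg Eu_nonneg)

lemma abs_sys_output_le:
  "\<bar>sys_output C Fu h u x t\<bar> \<le> (\<Sum>i\<in>UNIV. C i *v \<bar>x (t - h i)\<bar>) + Fu *v \<bar>u t\<bar>"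
  by (auto simp: sys_output_def intro!: order_trans[OF abs_triangle_ineq] order_trans[OF sum_abs]
      add_mono sum_mono abs_matrix_vector_mult_le C_nonneg Fu_nonneg)

text \<open>Summing the state inequalities over the delays and dropping the nonnegative output terms
  leaves a row certificate for \<open>At\<close>, hence stability. For the gain,
  \<open>m i \<bullet> \<bar>x t\<bar>\<close> are the storage functions.\<close>

lemma L1_sufficient:
  assumes m: "\<And>i. vlt 0 (m i)" "\<And>i. vlt ((\<Sum>k\<in>UNIV. m k) v* A i + 1 v* C i) (m i)"
    and \<gamma>: "vlt ((\<Sum>k\<in>UNIV. m k) v* Eu + 1 v* Fu) (\<gamma> *\<^sub>R 1)"
  shows "asym_stable A h" "L1_gain_lt A C Eu Fu h \<gamma>"
proof -
  define s where "s = (\<Sum>k\<in>UNIV. m k)"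
  have s0: "vlt 0 s" using vlt_sum[of "\<lambda>_. 0" m] m(1) by (simp add: s_def)
  have s: "0 \<le> s" using s0 by (rule vlt_imp_le)
  have le: "s v* A i + 1 v* C i \<le> m i" for i unfolding s_def by (rule vlt_imp_le[OF m(2)])
  have "s v* A i \<le> s v* A i + 1 v* C i" for i
    by (simp add: nonneg_mat_mult_nonneg_left[OF C_nonneg ones_nonneg])
  then have "vlt (s v* At) s"
    unfolding mult_At by (subst (2) s_def) (intro vlt_sum vlt_le_trans[OF _ m(2)[folded s_def]])
  then show "asym_stable A h" using vlt_left_imp_right[OF At_nonneg s0] asym_stable_if by blast
  define g where "g = s v* Eu + 1 v* Fu"
  \<comment> \<open>The largest of finitely many entries below \<open>\<gamma>\<close>: this is the
    uniform gap that the definition of the gain asks for.\<close>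
  define \<gamma>' where "\<gamma>' = Max (range (\<lambda>j. g $ j))"
  have g: "0 \<le> g" unfolding g_def
    by (intro add_nonneg_nonneg nonneg_mat_mult_nonneg_left Eu_nonneg Fu_nonneg s ones_nonneg)
  have g_le: "g \<le> \<gamma>' *\<^sub>R 1" by (simp add: less_eq_vec_def \<gamma>'_def)
  have \<gamma>'_less: "\<gamma>' < \<gamma>" using \<gamma> by (simp add: \<gamma>'_def vlt_def g_def s_def)
  have \<gamma>'_nonneg: "0 \<le> \<gamma>'" using g g_le by (auto simp: less_eq_vec_def intro: order_trans)
  have "L1_sig (sys_output C Fu h u x) \<and> L1_norm (sys_output C Fu h u x) \<le> \<gamma>' * L1_norm u"
    if u: "L1_sig u" and x0: "\<forall>t<0. x t = 0" and x: "is_traj A Eu h u x" for u x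
  proof -
    have um [measurable]: "u \<in> borel_measurable borel" using u by (simp add: L1_sig_def)
    have xm [measurable]: "x \<in> borel_measurable borel"
      using trajectory_measurable[OF um _ x] x0 by blast
    have ym [measurable]: "sys_output C Fu h u x \<in> borel_measurable borel"
      by (rule sys_output_measurable[OF um xm])
    let ?y = "sys_output C Fu h u x"
    have diss: "norm1 (?y t) + (\<Sum>i\<in>UNIV. m i \<bullet> \<bar>x t\<bar>)
        \<le> (\<Sum>i\<in>UNIV. m i \<bullet> \<bar>x (t - h i)\<bar>) + \<gamma>' * norm1 (u t)" if t: "0 \<le> t" for t
    proof -
      have "norm1 (?y t) \<le> 1 \<bullet> ((\<Sum>i\<in>UNIV. C i *v \<bar>x (t - h i)\<bar>) + Fu *v \<bar>u t\<bar>)"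
        unfolding norm1_eq_inner by (intro inner_mono_vec ones_nonneg abs_sys_output_le)
      moreover have "s \<bullet> \<bar>x t\<bar> \<le> s \<bullet> ((\<Sum>i\<in>UNIV. A i *v \<bar>x (t - h i)\<bar>) + Eu *v \<bar>u t\<bar>)"
        by (intro inner_mono_vec s abs_trajectory_le x t)
      ultimately have "norm1 (?y t) + s \<bullet> \<bar>x t\<bar>
          \<le> (\<Sum>i\<in>UNIV. (s v* A i + 1 v* C i) \<bullet> \<bar>x (t - h i)\<bar>) + g \<bullet> \<bar>u t\<bar>"
        by (simp add: g_def inner_add_right inner_add_left inner_sum_right sum.distrib dot_lmul_matrix)
      also have "\<dots> \<le> (\<Sum>i\<in>UNIV. m i \<bullet> \<bar>x (t - h i)\<bar>) + (\<gamma>' *\<^sub>R 1) \<bullet> \<bar>u t\<bar>"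
        by (intro add_mono sum_mono inner_mono_vec_left le g_le) auto
      finally show ?thesis by (simp add: s_def inner_sum_left norm1_eq_inner)
    qed
    have meas: "(\<lambda>t. m i \<bullet> \<bar>x t\<bar>) \<in> borel_measurable borel"
        "(\<lambda>t. norm1 (?y t)) \<in> borel_measurable borel" "(\<lambda>t. norm1 (u t)) \<in> borel_measurable borel" for i
      by measurable
    have nonneg: "0 \<le> m i \<bullet> \<bar>x t\<bar>" for i t
      using inner_mono_vec[OF vlt_imp_le[OF m(1)], of 0 "\<bar>x t\<bar>"] by simp
    have zero: "m i \<bullet> \<bar>x t\<bar> = 0" if "t < 0" for i t using x0 that by simp
    have int: "set_integrable lborel {0..} (\<lambda>t. norm1 (u t))" using u by (simp add: L1_sig_def)
    note dissipation_inequality[OF h_pos meas nonneg norm1_nonneg norm1_nonneg \<gamma>'_nonneg zero diss int]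
    then show ?thesis using ym by (simp add: L1_sig_def L1_norm_def)
  qed
  then show "L1_gain_lt A C Eu Fu h \<gamma>"
    unfolding L1_gain_lt_def using \<gamma>'_nonneg \<gamma>'_less by blast
qed

text \<open>Unit inputs turn the gain bound into a bound on the column sums of the static gain, and
  a slightly perturbed costate equation turns that into a certificate.\<close>

lemma L1_necessary:
  assumes stable: "asym_stable A h" and gain: "L1_gain_lt A C Eu Fu h \<gamma>"
  shows "\<exists>m. (\<forall>i. vlt 0 (m i)) \<and> (\<forall>i. vlt ((\<Sum>k\<in>UNIV. m k) v* A i + 1 v* C i) (m i)) \<and>
      vlt ((\<Sum>k\<in>UNIV. m k) v* Eu + 1 v* Fu) (\<gamma> *\<^sub>R 1)"
proof -
  obtain R where R: "nonneg_mat R" "(mat 1 - At) ** R = mat 1" "R ** (mat 1 - At) = mat 1"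
    using asym_stable_resolvent[OF stable] .
  obtain \<gamma>' where \<gamma>': "0 \<le> \<gamma>'" "\<gamma>' < \<gamma>"
    and gain': "\<And>u x. L1_sig u \<Longrightarrow> (\<forall>t<0. x t = 0) \<Longrightarrow> is_traj A Eu h u x \<Longrightarrow>
        L1_sig (sys_output C Fu h u x) \<and> L1_norm (sys_output C Fu h u x) \<le> \<gamma>' * L1_norm u"
    using gain unfolding L1_gain_lt_def by blast
  have "norm1 (dcgain R *v v) \<le> \<gamma>' * norm1 v" for v
  proof (rule integral_gain_lower_bound[OF stable R(2) continuous_on_norm1])
    fix u :: "real \<Rightarrow> real^'u" and x :: "real \<Rightarrow> real^'n"
    assume *: "u \<in> borel_measurable borel" "set_integrable lborel {0..} (\<lambda>t. norm1 (u t))"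
      "\<forall>t<0. x t = 0" "is_traj A Eu h u x"
    show "set_integrable lborel {0..} (\<lambda>t. norm1 (sys_output C Fu h u x t)) \<and>
        (LINT t:{0..}|lborel. norm1 (sys_output C Fu h u x t)) \<le> \<gamma>' * (LINT t:{0..}|lborel. norm1 (u t))"
      using gain'[OF _ *(3,4)] *(1,2) by (simp add: L1_sig_def L1_norm_def)
  qed (simp_all add: norm1_nonneg, simp add: norm1_def)
  from this[of "axis _ 1"] have col: "norm1 (dcgain R *v axis j 1) \<le> \<gamma>'" for j
    by (simp add: norm1_axis)
  have "(1 v* dcgain R) $ j < \<gamma>" for j
  proof -
    have "(1 v* dcgain R) $ j = 1 \<bullet> (dcgain R *v axis j 1)"
      by (simp add: dot_lmul_matrix[symmetric] inner_axis)
    also have "\<dots> \<le> norm1 (dcgain R *v axis j 1)"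
      unfolding norm1_eq_inner by (intro inner_mono_vec ones_nonneg abs_ge_self)
    finally show ?thesis using col[of j] \<gamma>'(2) by linarith
  qed
  then have "vlt (1 v* dcgain R) (\<gamma> *\<^sub>R 1)" by (simp add: vlt_def)
  \<comment> \<open>The perturbing vector is what a forcing \<open>\<epsilon> *\<^sub>R 1\<close> of
    the costate \<open>s\<close> adds to the input inequality.\<close>
  then obtain \<epsilon> where \<epsilon>: "\<epsilon> > 0" "vlt (1 v* dcgain R + \<epsilon> *\<^sub>R ((1 v* R) v* Eu)) (\<gamma> *\<^sub>R 1)"
    using vlt_perturb by blast
  define s where "s = (1 v* Ct + \<epsilon> *\<^sub>R 1) v* R"
  have "s v* (mat 1 - At) = 1 v* Ct + \<epsilon> *\<^sub>R 1" by (simp add: s_def vector_matrix_mul_assoc R)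
  then have s_eq: "s = s v* At + 1 v* Ct + \<epsilon> *\<^sub>R 1"
    by (simp add: vector_matrix_mult_diff_rdistrib algebra_simps)
  have s0: "0 \<le> s" unfolding s_def
    using \<epsilon>(1) by (intro nonneg_mat_mult_nonneg_left R(1) add_nonneg_nonneg Ct_nonneg ones_nonneg scaleR_nonneg_nonneg) auto
  \<comment> \<open>The slack is divided evenly over the delays: each block inequality becomes
    strict, and the blocks still sum to \<open>s\<close> by its equation.\<close>
  define m where "m i = s v* A i + 1 v* C i + (\<epsilon> / real CARD('i)) *\<^sub>R 1" for i
  have "(\<Sum>k\<in>UNIV. m k) = s v* At + 1 v* Ct + \<epsilon> *\<^sub>R 1"
    by (simp add: m_def sum.distrib mult_At mult_Ct sum_constant_scaleR del: sum_constant)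
  then have sum_m: "(\<Sum>k\<in>UNIV. m k) = s" using s_eq by simp
  have lt: "vlt (s v* A i + 1 v* C i) (m i)" for i
    using \<epsilon>(1) by (simp add: vlt_def m_def)
  have "0 \<le> s v* A i + 1 v* C i" for i
    by (intro add_nonneg_nonneg nonneg_mat_mult_nonneg_left A_nonneg C_nonneg s0 ones_nonneg)
  then have "vlt 0 (m i)" for i using lt vlt_le_trans by blast
  moreover have "s v* Eu + 1 v* Fu = 1 v* dcgain R + \<epsilon> *\<^sub>R ((1 v* R) v* Eu)"
    by (simp add: s_def mult_dcgain vector_matrix_left_distrib scaleR_vector_matrix_assoc)
  ultimately show ?thesis using lt \<epsilon>(2) by (intro exI[of _ m]) (simp add: sum_m)
qed

end

subsection \<open>The $L_\infty$-gain\<close>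

lemma Linf_lp_blocks:
  "(\<exists>\<mu> :: real^('i::finite \<times> 'n::finite). vlt 0 \<mu> \<and>
      vlt (blk (ones_kron (mat 1) ** blockrow A) (ones_kron Eu) (blockrow C) Fu *v vcat \<mu> (1 :: real^'u))
          (vcat \<mu> (\<gamma> *\<^sub>R (1 :: real^'y)))) \<longleftrightarrow>
   (\<exists>m. (\<forall>i. vlt 0 (m i)) \<and> (\<forall>i. vlt ((\<Sum>k\<in>UNIV. A k *v m k) + Eu *v 1) (m i)) \<and>
      vlt ((\<Sum>k\<in>UNIV. C k *v m k) + Fu *v 1) (\<gamma> *\<^sub>R 1))"
  by (subst ex_blockvec) (simp add: blk_mult_vcat matrix_vector_mul_assoc[symmetric]
      ones_kron_mult blockrow_mult_blockvec blockvec_add vlt_vcat vlt_blockvec vlt_0_blockvec conj_assoc)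

text \<open>A null set cannot contain \<open>{a..a+1}\<close>. It yields actual late times at which
  an almost-everywhere bound holds.\<close>

lemma AE_lborel_unbounded:
  assumes "AE t in lborel. P (t::real)"
  shows "\<exists>t\<ge>a. P t"
proof (rule ccontr)
  assume none: "\<not> ?thesis"
  obtain N where N: "{t. \<not> P t} \<subseteq> N" "emeasure lborel N = 0" "N \<in> sets lborel"
    using AE_E[OF assms] by auto
  have "emeasure lborel {a..a+1} \<le> emeasure lborel N"
    by (rule emeasure_mono) (use N none in \<open>auto simp: subset_iff\<close>)
  then show False using N by simp
qed

lemma AE_lborel_shift:
  assumes "Measurable.pred borel P" "AE t in lborel. P t"
  shows "AE t in lborel. P (t - d :: real)"
  using AE_borel_affine[of 1 P "- d"] assms by simp

lemma Linf_norm_le_iff: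
  assumes [measurable]: "w \<in> borel_measurable borel"
  shows "Linf_norm w \<le> ereal c \<longleftrightarrow> (AE t in lborel. 0 \<le> t \<longrightarrow> norminf (w t) \<le> c)"
proof
  assume le: "Linf_norm w \<le> ereal c"
  have "AE t in restrict_space lborel {0..}. ereal (norminf (w t)) \<le> Linf_norm w"
    unfolding Linf_norm_def by (rule esssup_AE)
  then have "AE t in lborel. 0 \<le> t \<longrightarrow> ereal (norminf (w t)) \<le> Linf_norm w"
    by (subst (asm) AE_restrict_space_iff) auto
  then show "AE t in lborel. 0 \<le> t \<longrightarrow> norminf (w t) \<le> c"
    using le by (auto elim!: eventually_mono dest: order_trans)
next
  assume *: "AE t in lborel. 0 \<le> t \<longrightarrow> norminf (w t) \<le> c"
  show "Linf_norm w \<le> ereal c" unfolding Linf_norm_def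
  proof (rule esssup_I)
    show "(\<lambda>t. ereal (norminf (w t))) \<in> borel_measurable (restrict_space lborel {0..})"
      by (rule measurable_restrict_space1) measurable
    show "AE t in restrict_space lborel {0..}. ereal (norminf (w t)) \<le> ereal c"
      using * by (subst AE_restrict_space_iff) auto
  qed
qed

text \<open>The extended-real value is below infinity by assumption and cannot be minus infinity,
  since a negative bound would fail at some actual time.\<close>

lemma Linf_norm_real:
  assumes "Linf_sig w"
  obtains r where "0 \<le> r" "Linf_norm w = ereal r" "AE t in lborel. 0 \<le> t \<longrightarrow> norminf (w t) \<le> r"
proof -
  have w: "w \<in> borel_measurable borel" "Linf_norm w < \<infinity>" using assms by (auto simp: Linf_sig_def)
  have "\<not> Linf_norm w \<le> ereal (- 1)"
  proof
    assume "Linf_norm w \<le> ereal (- 1)"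
    from AE_lborel_unbounded[OF this[unfolded Linf_norm_le_iff[OF w(1)]], of 0]
    obtain t where "norminf (w t) \<le> - 1" by auto
    then show False using norminf_nonneg[of "w t"] by linarith
  qed
  then obtain r where r: "Linf_norm w = ereal r" using w(2) by (cases "Linf_norm w") auto
  have ae: "AE t in lborel. 0 \<le> t \<longrightarrow> norminf (w t) \<le> r"
    using r Linf_norm_le_iff[OF w(1), of r] by simp
  then obtain t where "norminf (w t) \<le> r" using AE_lborel_unbounded[OF ae, of 0] by auto
  then have "0 \<le> r" using norminf_nonneg order_trans by blast
  then show thesis using that r ae by blast
qed

lemma norminf_le_iff_abs: "norminf v \<le> c \<longleftrightarrow> \<bar>v\<bar> \<le> c *\<^sub>R 1"
  by (simp add: norminf_le_iff less_eq_vec_def abs_vec_def)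

context positive_delay_system
begin

text \<open>The box given by \<open>r *\<^sub>R p\<close> is invariant. As the input bound holds
  only almost everywhere, exceptional null sets are carried along: each step of length
  \<open>\<delta>\<close> adds finitely many shifts, and countably many steps cover all
  times.\<close>

lemma abs_trajectory_AE_le:
  assumes p: "0 \<le> p" "At *v p + Eu *v 1 \<le> p" and r: "0 \<le> r"
    and u: "AE t in lborel. 0 \<le> t \<longrightarrow> \<bar>u t\<bar> \<le> r *\<^sub>R 1"
    and xm [measurable]: "x \<in> borel_measurable borel"
    and x0: "\<forall>t<0. x t = 0" and x: "is_traj A Eu h u x"
  shows "AE t in lborel. \<bar>x t\<bar> \<le> r *\<^sub>R p"
proof -
  \<comment> \<open>Shifting an almost-everywhere statement needs a measurable predicate; the box is
    closed, hence Borel.\<close>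
  define S where "S = {v :: real^'n. \<bar>v\<bar> \<le> r *\<^sub>R p}"
  have "closed S" unfolding S_def less_eq_vec_def abs_vec_def
    by simp (intro closed_Collect_all closed_Collect_le continuous_intros)
  then have [measurable]: "S \<in> sets borel" by simp
  have "AE t in lborel. t < real k * \<delta> \<longrightarrow> x t \<in> S" for k
  proof (induction k)
    case 0
    then show ?case using x0 p r by (simp add: S_def scaleR_nonneg_nonneg)
  next
    case (Suc k)
    have "AE t in lborel. \<forall>i\<in>UNIV. t - h i < real k * \<delta> \<longrightarrow> x (t - h i) \<in> S"
      by (intro AE_finite_allI AE_lborel_shift[where P = "\<lambda>t. t < real k * \<delta> \<longrightarrow> x t \<in> S"] Suc) simp_all
    then show ?case using u
    proof eventually_elim
      case (elim t)
      show ?case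
      proof (intro impI)
        assume t: "t < real (Suc k) * \<delta>"
        show "x t \<in> S"
        proof (cases "t < 0")
          case True
          then show ?thesis using x0 p r by (simp add: S_def scaleR_nonneg_nonneg)
        next
          case False
          have "t - h i < real k * \<delta>" for i using t \<delta>_le[of i] by (simp add: algebra_simps)
          then have S: "\<bar>x (t - h i)\<bar> \<le> r *\<^sub>R p" for i using elim by (simp add: S_def)
          have "\<bar>x t\<bar> \<le> (\<Sum>i\<in>UNIV. A i *v \<bar>x (t - h i)\<bar>) + Eu *v \<bar>u t\<bar>"
            using abs_trajectory_le[OF x] False by simp
          also have "\<dots> \<le> (\<Sum>i\<in>UNIV. A i *v (r *\<^sub>R p)) + Eu *v (r *\<^sub>R 1)"
            using S elim False by (intro add_mono sum_mono nonneg_mat_mono A_nonneg Eu_nonneg) auto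
          also have "\<dots> = r *\<^sub>R (At *v p + Eu *v 1)"
            by (simp add: At_mult matrix_vector_mult_scaleR scaleR_sum_right scaleR_add_right)
          also have "\<dots> \<le> r *\<^sub>R p" by (rule scaleR_left_mono[OF p(2) r])
          finally show ?thesis by (simp add: S_def)
        qed
      qed
    qed
  qed
  then have "AE t in lborel. \<forall>k. t < real k * \<delta> \<longrightarrow> x t \<in> S"
    unfolding AE_all_countable by blast
  then show ?thesis
  proof eventually_elim
    case (elim t)
    obtain k where "t / \<delta> < real k" using reals_Archimedean2 by blast
    then have "t < real k * \<delta>" using \<delta>_pos by (simp add: field_simps)
    then show ?case using elim unfolding S_def by blast
  qed
qed

lemma Linf_sufficient:
  assumes m: "\<And>i. vlt 0 (m i)" "\<And>i. vlt ((\<Sum>k\<in>UNIV. A k *v m k) + Eu *v 1) (m i)"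
    and \<gamma>: "vlt ((\<Sum>k\<in>UNIV. C k *v m k) + Fu *v 1) (\<gamma> *\<^sub>R 1)"
  shows "asym_stable A h" "Linf_gain_lt A C Eu Fu h \<gamma>"
proof -
  \<comment> \<open>All block inequalities share one left-hand side, so the entrywise minimum of the
    blocks lies above it too. Replacing every block by this minimum only lowers the left-hand
    side.\<close>
  define p :: "real^'n" where "p = (\<chi> n. Min (range (\<lambda>i. m i $ n)))"
  have p_le: "p \<le> m i" for i by (simp add: p_def less_eq_vec_def)
  have p0: "vlt 0 p" using m(1) by (simp add: p_def vlt_def)
  have p_nonneg: "0 \<le> p" using p0 by (rule vlt_imp_le)
  have "At *v p + Eu *v 1 \<le> (\<Sum>k\<in>UNIV. A k *v m k) + Eu *v 1"
    unfolding At_mult by (intro add_right_mono sum_mono nonneg_mat_mono A_nonneg p_le)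
  moreover have "vlt ((\<Sum>k\<in>UNIV. A k *v m k) + Eu *v 1) p" using m(2) by (simp add: p_def vlt_def)
  ultimately have p_lt: "vlt (At *v p + Eu *v 1) p" by (rule vlt_le_trans)
  have "At *v p \<le> At *v p + Eu *v 1"
    by (simp add: nonneg_mat_mult_nonneg[OF Eu_nonneg ones_nonneg])
  then show "asym_stable A h" using asym_stable_if[OF p0] p_lt vlt_le_trans by blast
  define g where "g = Ct *v p + Fu *v 1"
  have "g \<le> (\<Sum>k\<in>UNIV. C k *v m k) + Fu *v 1"
    unfolding g_def Ct_mult by (intro add_right_mono sum_mono nonneg_mat_mono C_nonneg p_le)
  then have g_lt: "vlt g (\<gamma> *\<^sub>R 1)" using \<gamma> vlt_le_trans by blast
  define \<gamma>' where "\<gamma>' = Max (range (\<lambda>j. g $ j))"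
  have g: "0 \<le> g" unfolding g_def
    by (intro add_nonneg_nonneg nonneg_mat_mult_nonneg Ct_nonneg Fu_nonneg p_nonneg ones_nonneg)
  have g_le: "g \<le> \<gamma>' *\<^sub>R 1" by (simp add: less_eq_vec_def \<gamma>'_def)
  have \<gamma>'_less: "\<gamma>' < \<gamma>" using g_lt by (simp add: \<gamma>'_def vlt_def)
  have \<gamma>'_nonneg: "0 \<le> \<gamma>'" using g g_le by (auto simp: less_eq_vec_def intro: order_trans)
  have "Linf_sig (sys_output C Fu h u x) \<and> Linf_norm (sys_output C Fu h u x) \<le> ereal \<gamma>' * Linf_norm u"
    if u: "Linf_sig u" and x0: "\<forall>t<0. x t = 0" and x: "is_traj A Eu h u x" for u x
  proof -
    let ?y = "sys_output C Fu h u x"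
    have um: "u \<in> borel_measurable borel" using u by (simp add: Linf_sig_def)
    have xm [measurable]: "x \<in> borel_measurable borel"
      using trajectory_measurable[OF um _ x] x0 by blast
    have ym: "?y \<in> borel_measurable borel" by (rule sys_output_measurable[OF um xm])
    obtain r where r: "0 \<le> r" "Linf_norm u = ereal r"
      and "AE t in lborel. 0 \<le> t \<longrightarrow> norminf (u t) \<le> r" using Linf_norm_real[OF u] .
    then have u_le: "AE t in lborel. 0 \<le> t \<longrightarrow> \<bar>u t\<bar> \<le> r *\<^sub>R 1" by (simp add: norminf_le_iff_abs)
    define S where "S = {v :: real^'n. \<bar>v\<bar> \<le> r *\<^sub>R p}"
    have "closed S" unfolding S_def less_eq_vec_def abs_vec_def
      by simp (intro closed_Collect_all closed_Collect_le continuous_intros)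
    then have [measurable]: "S \<in> sets borel" by simp
    have "AE t in lborel. x t \<in> S"
      unfolding S_def using abs_trajectory_AE_le[OF p_nonneg vlt_imp_le[OF p_lt] r(1) u_le xm x0 x] by simp
    then have "AE t in lborel. \<forall>i\<in>UNIV. x (t - h i) \<in> S"
      by (intro AE_finite_allI AE_lborel_shift[where P = "\<lambda>t. x t \<in> S"]) simp_all
    then have "AE t in lborel. 0 \<le> t \<longrightarrow> norminf (?y t) \<le> \<gamma>' * r" using u_le
    proof eventually_elim
      case (elim t)
      show ?case
      proof
        assume t: "0 \<le> t"
        have "\<bar>?y t\<bar> \<le> (\<Sum>i\<in>UNIV. C i *v \<bar>x (t - h i)\<bar>) + Fu *v \<bar>u t\<bar>"
          by (rule abs_sys_output_le)
        also have "\<dots> \<le> (\<Sum>i\<in>UNIV. C i *v (r *\<^sub>R p)) + Fu *v (r *\<^sub>R 1)"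
          using elim t by (intro add_mono sum_mono nonneg_mat_mono C_nonneg Fu_nonneg) (auto simp: S_def)
        also have "\<dots> = r *\<^sub>R g"
          by (simp add: g_def Ct_mult matrix_vector_mult_scaleR scaleR_sum_right scaleR_add_right)
        also have "\<dots> \<le> r *\<^sub>R (\<gamma>' *\<^sub>R 1)" by (rule scaleR_left_mono[OF g_le r(1)])
        finally show "norminf (?y t) \<le> \<gamma>' * r" by (simp add: norminf_le_iff_abs mult.commute)
      qed
    qed
    then have "Linf_norm ?y \<le> ereal (\<gamma>' * r)" using Linf_norm_le_iff[OF ym] by blast
    then show ?thesis using ym r le_less_trans[of _ "ereal (\<gamma>' * r)" \<infinity>] by (simp add: Linf_sig_def)
  qed
  then show "Linf_gain_lt A C Eu Fu h \<gamma>"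
    unfolding Linf_gain_lt_def using \<gamma>'_nonneg \<gamma>'_less by blast
qed

text \<open>The constant input \<open>1\<close> is itself admissible here, so the step response is
  used without truncation; its limit \<open>dcgain R *v 1\<close> inherits the bound
  \<open>\<gamma>'\<close>.\<close>

lemma Linf_necessary:
  assumes stable: "asym_stable A h" and gain: "Linf_gain_lt A C Eu Fu h \<gamma>"
  shows "\<exists>m. (\<forall>i. vlt 0 (m i)) \<and> (\<forall>i. vlt ((\<Sum>k\<in>UNIV. A k *v m k) + Eu *v 1) (m i)) \<and>
      vlt ((\<Sum>k\<in>UNIV. C k *v m k) + Fu *v 1) (\<gamma> *\<^sub>R 1)"
proof -
  obtain R where R: "nonneg_mat R" "(mat 1 - At) ** R = mat 1" "R ** (mat 1 - At) = mat 1"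
    using asym_stable_resolvent[OF stable] .
  obtain \<gamma>' where \<gamma>': "0 \<le> \<gamma>'" "\<gamma>' < \<gamma>"
    and gain': "\<And>u x. Linf_sig u \<Longrightarrow> (\<forall>t<0. x t = 0) \<Longrightarrow> is_traj A Eu h u x \<Longrightarrow>
        Linf_sig (sys_output C Fu h u x) \<and> Linf_norm (sys_output C Fu h u x) \<le> ereal \<gamma>' * Linf_norm u"
    using gain unfolding Linf_gain_lt_def by blast
  define u :: "real \<Rightarrow> real^'u" where "u = (\<lambda>_. 1)"
  obtain x where x0: "\<forall>t<0. x t = 0" and x: "is_traj A Eu h u x"
    using trajectory_exists[of "\<lambda>_. 0" "\<lambda>_. Eu *v 1"] unfolding is_traj_def u_def by blast
  define y where "y = sys_output C Fu h u x"
  have u1: "Linf_norm u \<le> ereal 1"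
    by (subst Linf_norm_le_iff) (auto simp: u_def norminf_le_iff)
  then have "Linf_sig u"
    using le_less_trans[of _ "ereal 1" \<infinity>] by (simp add: Linf_sig_def) (simp add: u_def)
  with gain' x0 x have y: "Linf_sig y" "Linf_norm y \<le> ereal \<gamma>' * Linf_norm u" by (auto simp: y_def)
  have "ereal \<gamma>' * Linf_norm u \<le> ereal \<gamma>' * ereal 1" using \<gamma>' u1 by (intro ereal_mult_left_mono) auto
  then have "Linf_norm y \<le> ereal \<gamma>'" using y(2) order_trans by fastforce
  then have y_le: "AE t in lborel. 0 \<le> t \<longrightarrow> norminf (y t) \<le> \<gamma>'"
    using y(1) Linf_norm_le_iff by (auto simp: Linf_sig_def)
  have lim: "(y \<longlongrightarrow> dcgain R *v 1) at_top"
    using step_response[OF stable R(2) _ x[unfolded u_def]] x0 by (auto simp: y_def u_def)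
  have "(dcgain R *v 1) $ j \<le> \<gamma>'" for j
  proof (rule ccontr)
    assume "\<not> (dcgain R *v 1) $ j \<le> \<gamma>'"
    then have "\<forall>\<^sub>F t in at_top. \<gamma>' < y t $ j"
      by (intro order_tendstoD(1)[OF tendsto_vec_nth[OF lim]]) (simp only: not_le)
    then obtain T where T: "\<And>t. T \<le> t \<Longrightarrow> \<gamma>' < y t $ j" by (auto simp: eventually_at_top_linorder)
    \<comment> \<open>The limit gives a pointwise lower bound, the gain only an almost-everywhere
      upper bound; a late time outside the null set satisfies both.\<close>
    obtain t where "max T 0 \<le> t" "norminf (y t) \<le> \<gamma>'"
      using AE_lborel_unbounded[OF y_le, of "max T 0"] by auto
    then have "T \<le> t" "\<bar>y t $ j\<bar> \<le> \<gamma>'" by (auto simp: norminf_le_iff)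
    then show False using T[of t] by linarith
  qed
  then have "vlt (dcgain R *v 1) (\<gamma> *\<^sub>R 1)" using \<gamma>'(2) by (auto simp: vlt_def intro: le_less_trans)
  then obtain \<epsilon> where \<epsilon>: "\<epsilon> > 0" "vlt (dcgain R *v 1 + \<epsilon> *\<^sub>R (Ct *v (R *v 1))) (\<gamma> *\<^sub>R 1)"
    using vlt_perturb by blast
  \<comment> \<open>Equilibrium for input \<open>1\<close> with extra forcing
    \<open>\<epsilon> *\<^sub>R 1\<close>, which makes the state inequality strict. The certificate
    takes every block equal to \<open>p\<close>.\<close>
  define p where "p = R *v (Eu *v 1 + \<epsilon> *\<^sub>R 1)"
  have "(mat 1 - At) *v p = Eu *v 1 + \<epsilon> *\<^sub>R 1" by (simp add: p_def R matrix_vector_mul_assoc)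
  then have p_eq: "p = At *v p + Eu *v 1 + \<epsilon> *\<^sub>R 1"
    by (simp add: matrix_vector_mult_diff_rdistrib algebra_simps)
  have p0: "0 \<le> p" unfolding p_def using \<epsilon>(1)
    by (intro nonneg_mat_mult_nonneg R(1) add_nonneg_nonneg Eu_nonneg ones_nonneg scaleR_nonneg_nonneg) auto
  have lt: "vlt (At *v p + Eu *v 1) p" by (subst (2) p_eq) (simp add: vlt_def \<epsilon>(1))
  have "0 \<le> At *v p + Eu *v 1"
    by (intro add_nonneg_nonneg nonneg_mat_mult_nonneg At_nonneg Eu_nonneg p0 ones_nonneg)
  then have "vlt 0 p" using lt vlt_le_trans by blast
  moreover have "Ct *v p + Fu *v 1 = dcgain R *v 1 + \<epsilon> *\<^sub>R (Ct *v (R *v 1))"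
    by (simp add: p_def dcgain_mult matrix_vector_right_distrib matrix_vector_mult_scaleR)
  ultimately show ?thesis using lt \<epsilon>(2)
    by (intro exI[of _ "\<lambda>_. p"]) (simp add: At_mult[symmetric] Ct_mult[symmetric])
qed

end

subsection \<open>The $L_2$-gain\<close>

text \<open>The four block rows are grouped in pairs, so that all coupling between the first pair
  (delayed states, input) and the second sits in one block and its transpose.\<close>

definition L2_lmi where
  "L2_lmi A C Eu Fu Q \<gamma> =
     blk (blk (- blockdiag Q) (0 :: real^'u::finite^('i::finite \<times> 'n::finite)) 0 (- (\<gamma> *\<^sub>R mat 1)))
         (transpose (blk (blockcol Q ** blockrow A) (blockcol (\<lambda>i. Q i ** Eu)) (blockrow C) Fu))
         (blk (blockcol Q ** blockrow A) (blockcol (\<lambda>i. Q i ** Eu)) (blockrow C) Fu)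
         (blk (- blockdiag Q) (0 :: real^'y::finite^('i \<times> 'n)) 0 (- (\<gamma> *\<^sub>R mat 1)))"

lemma uminus_matrix_vector_mult: "(- M) *v (x :: real^'c) = - (M *v x)"
  by (simp add: vec_eq_iff matrix_vector_mult_def sum_negf)

text \<open>The two coupling blocks contribute equal scalars, hence the factor 2; the diagonal
  blocks give the negative squares.\<close>

lemma L2_lmi_form:
  fixes A :: "'i::finite \<Rightarrow> real^'n::finite^'n" and C :: "'i \<Rightarrow> real^'n^'y::finite"
    and Eu :: "real^'u::finite^'n" and Fu :: "real^'u^'y"
    and \<xi> \<zeta> :: "'i \<Rightarrow> real^'n" and u :: "real^'u" and \<eta> :: "real^'y"
  defines "v \<equiv> vcat (vcat (blockvec \<xi>) u) (vcat (blockvec \<zeta>) \<eta>)"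
    and "z \<equiv> (\<Sum>i\<in>UNIV. A i *v \<xi> i) + Eu *v u" and "y \<equiv> (\<Sum>i\<in>UNIV. C i *v \<xi> i) + Fu *v u"
  shows "v \<bullet> (L2_lmi A C Eu Fu Q \<gamma> *v v) =
    2 * ((\<Sum>i\<in>UNIV. \<zeta> i \<bullet> (Q i *v z)) + \<eta> \<bullet> y)
    - (\<Sum>i\<in>UNIV. \<xi> i \<bullet> (Q i *v \<xi> i)) - \<gamma> * (u \<bullet> u)
    - (\<Sum>i\<in>UNIV. \<zeta> i \<bullet> (Q i *v \<zeta> i)) - \<gamma> * (\<eta> \<bullet> \<eta>)"
proof -
  let ?B = "blk (blockcol Q ** blockrow A) (blockcol (\<lambda>i. Q i ** Eu)) (blockrow C) Fu"
  define a where "a = vcat (blockvec \<xi>) u"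
  define b where "b = vcat (blockvec \<zeta>) \<eta>"
  have B: "?B *v a = vcat (blockvec (\<lambda>i. Q i *v z)) y"
    by (simp add: a_def blk_mult_vcat matrix_vector_mul_assoc[symmetric] blockrow_mult_blockvec
        blockcol_mult blockvec_add matrix_vector_right_distrib[symmetric] z_def y_def)
  have "a \<bullet> (transpose ?B *v b) = b \<bullet> (?B *v a)"
    by (simp add: dot_lmul_matrix inner_commute[of a])
  then have "v \<bullet> (L2_lmi A C Eu Fu Q \<gamma> *v v) = 2 * (b \<bullet> (?B *v a))
      + a \<bullet> (blk (- blockdiag Q) 0 0 (- (\<gamma> *\<^sub>R mat 1)) *v a)
      + b \<bullet> (blk (- blockdiag Q) 0 0 (- (\<gamma> *\<^sub>R mat 1)) *v b)"
    by (simp add: v_def a_def[symmetric] b_def[symmetric] L2_lmi_def blk_mult_vcat inner_vcat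
        inner_add_right)
  then show ?thesis
    unfolding B by (simp add: a_def b_def blk_mult_vcat inner_vcat inner_blockvec
        uminus_matrix_vector_mult blockdiag_mult_blockvec scaleR_matrix_vector_assoc[symmetric])
qed

lemma transpose_blk: "transpose (blk M11 M12 M21 M22)
    = blk (transpose M11) (transpose M21) (transpose M12) (transpose M22)"
  by (auto simp: vec_eq_iff blk_def transpose_def split: sum.split)

lemma transpose_zero: "transpose (0 :: real^'k^'l) = 0"
  by (simp add: vec_eq_iff transpose_def)

lemma transpose_scaled_identity: "transpose (- (c *\<^sub>R mat 1 :: real^'k^'k)) = - (c *\<^sub>R mat 1)"
  by (simp add: vec_eq_iff transpose_def mat_def)

lemma transpose_L2_lmi:
  assumes Q: "\<And>i. transpose (Q i) = Q i"
  shows "transpose (L2_lmi A C Eu Fu Q \<gamma>) = L2_lmi A C Eu Fu Q \<gamma>"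
proof -
  have "Q i $ j $ k = Q i $ k $ j" for i j k
    using arg_cong[OF Q[of i], of "\<lambda>M. M $ k $ j"] by (simp add: transpose_def)
  then have "transpose (- blockdiag Q) = - blockdiag Q"
    by (simp add: vec_eq_iff transpose_def blockdiag_def)
  then show ?thesis by (simp add: L2_lmi_def transpose_blk transpose_zero transpose_scaled_identity)
qed

text \<open>On the compact unit sphere the form attains a maximum, which is negative; homogeneity
  extends the bound to all vectors. The margin \<open>\<epsilon>\<close> becomes the strict gap in
  the gain.\<close>

lemma neg_def_coercive:
  fixes M :: "real^'n^'n"
  assumes "neg_def M"
  shows "\<exists>\<epsilon>>0. \<forall>x. x \<bullet> (M *v x) + \<epsilon> * (x \<bullet> x) \<le> 0"
proof -
  have "\<exists>x\<in>sphere 0 1. \<forall>y\<in>sphere 0 1. y \<bullet> (M *v y) \<le> x \<bullet> (M *v x)"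
    by (intro continuous_attains_sup compact_sphere continuous_intros
        linear_continuous_on matrix_vector_mul_bounded_linear) (auto simp: sphere_eq_empty)
  then obtain a where a: "norm a = 1" "\<And>y. norm y = 1 \<Longrightarrow> y \<bullet> (M *v y) \<le> a \<bullet> (M *v a)" by auto
  define \<epsilon> where "\<epsilon> = - (a \<bullet> (M *v a))"
  have "a \<noteq> 0" using a(1) by auto
  then have "\<epsilon> > 0" using assms by (auto simp: neg_def_def \<epsilon>_def)
  moreover have "x \<bullet> (M *v x) + \<epsilon> * (x \<bullet> x) \<le> 0" for x
  proof (cases "x = 0")
    case False
    define y where "y = (1 / norm x) *\<^sub>R x"
    have "norm y = 1" using False by (simp add: y_def)
    have x: "x = norm x *\<^sub>R y" using False by (simp add: y_def)
    have "x \<bullet> (M *v x) = (norm x)\<^sup>2 * (y \<bullet> (M *v y))"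
      by (subst (1 2) x) (simp add: matrix_vector_mult_scaleR power2_eq_square)
    also have "\<dots> \<le> (norm x)\<^sup>2 * (- \<epsilon>)"
      using a(2)[OF \<open>norm y = 1\<close>] by (intro mult_left_mono) (auto simp: \<epsilon>_def)
    finally show ?thesis by (simp add: power2_norm_eq_inner algebra_simps)
  qed simp
  ultimately show ?thesis by blast
qed

text \<open>
  The choice \<open>\<zeta> i = z\<close>, \<open>\<eta> = y / \<gamma>\<close> maximises the quadratic form of the LMI over its last two blocks
  and so eliminates them (Schur complement).
\<close>

lemma L2_lmi_imp:
  fixes A :: "'i::finite \<Rightarrow> real^'n::finite^'n" and C :: "'i \<Rightarrow> real^'n^'y::finite"
    and Eu :: "real^'u::finite^'n" and Fu :: "real^'u^'y"
  assumes neg: "neg_def (L2_lmi A C Eu Fu Q \<gamma>)"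
  shows "0 < \<gamma>"
    and "\<exists>\<epsilon>>0. \<forall>\<xi> u.
      (\<Sum>i\<in>UNIV. ((\<Sum>i\<in>UNIV. A i *v \<xi> i) + Eu *v u) \<bullet> (Q i *v ((\<Sum>i\<in>UNIV. A i *v \<xi> i) + Eu *v u)))
      + (norm ((\<Sum>i\<in>UNIV. C i *v \<xi> i) + Fu *v u))\<^sup>2 / \<gamma> + \<epsilon> * ((\<Sum>i\<in>UNIV. \<xi> i \<bullet> \<xi> i) + u \<bullet> u)
      \<le> (\<Sum>i\<in>UNIV. \<xi> i \<bullet> (Q i *v \<xi> i)) + \<gamma> * (u \<bullet> u)"
proof -
  obtain \<epsilon> where \<epsilon>: "\<epsilon> > 0"
    and coercive: "\<And>x. x \<bullet> (L2_lmi A C Eu Fu Q \<gamma> *v x) + \<epsilon> * (x \<bullet> x) \<le> 0"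
    using neg_def_coercive[OF neg] by blast
  have form: "2 * ((\<Sum>i\<in>UNIV. \<zeta> i \<bullet> (Q i *v ((\<Sum>i\<in>UNIV. A i *v \<xi> i) + Eu *v u)))
        + \<eta> \<bullet> ((\<Sum>i\<in>UNIV. C i *v \<xi> i) + Fu *v u))
      - (\<Sum>i\<in>UNIV. \<xi> i \<bullet> (Q i *v \<xi> i)) - \<gamma> * (u \<bullet> u)
      - (\<Sum>i\<in>UNIV. \<zeta> i \<bullet> (Q i *v \<zeta> i)) - \<gamma> * (\<eta> \<bullet> \<eta>)
      + \<epsilon> * ((\<Sum>i\<in>UNIV. \<xi> i \<bullet> \<xi> i) + u \<bullet> u + ((\<Sum>i\<in>UNIV. \<zeta> i \<bullet> \<zeta> i) + \<eta> \<bullet> \<eta>)) \<le> 0"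
    for \<xi> u \<zeta> \<eta>
    using coercive[of "vcat (vcat (blockvec \<xi>) u) (vcat (blockvec \<zeta>) \<eta>)"]
    unfolding L2_lmi_form inner_vcat inner_blockvec .
  \<comment> \<open>Testing a vector supported on the last block alone shows that
    \<open>\<gamma>\<close> is positive, which is not assumed.\<close>
  have "\<epsilon> * ((1::real^'y) \<bullet> 1) \<le> \<gamma> * ((1::real^'y) \<bullet> 1)"
    using form[where \<xi> = "\<lambda>_. 0" and u = 0 and \<zeta> = "\<lambda>_. 0" and \<eta> = 1] by simp
  then show \<gamma>: "0 < \<gamma>" using \<epsilon> by (simp add: inner_vec_def)
  show "\<exists>\<epsilon>>0. \<forall>\<xi> u.
      (\<Sum>i\<in>UNIV. ((\<Sum>i\<in>UNIV. A i *v \<xi> i) + Eu *v u) \<bullet> (Q i *v ((\<Sum>i\<in>UNIV. A i *v \<xi> i) + Eu *v u)))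
      + (norm ((\<Sum>i\<in>UNIV. C i *v \<xi> i) + Fu *v u))\<^sup>2 / \<gamma> + \<epsilon> * ((\<Sum>i\<in>UNIV. \<xi> i \<bullet> \<xi> i) + u \<bullet> u)
      \<le> (\<Sum>i\<in>UNIV. \<xi> i \<bullet> (Q i *v \<xi> i)) + \<gamma> * (u \<bullet> u)"
  proof (intro exI[of _ \<epsilon>] conjI \<epsilon> allI)
    fix \<xi> u
    define z where "z = (\<Sum>i\<in>UNIV. A i *v \<xi> i) + Eu *v u"
    define y where "y = (\<Sum>i\<in>UNIV. C i *v \<xi> i) + Fu *v u"
    have "0 \<le> \<epsilon> * ((\<Sum>i\<in>(UNIV :: 'i set). z \<bullet> z) + ((1 / \<gamma>) *\<^sub>R y) \<bullet> ((1 / \<gamma>) *\<^sub>R y))"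
      using \<epsilon> by (intro mult_nonneg_nonneg add_nonneg_nonneg sum_nonneg) auto
    moreover have "\<gamma> * (((1 / \<gamma>) *\<^sub>R y) \<bullet> ((1 / \<gamma>) *\<^sub>R y)) = (norm y)\<^sup>2 / \<gamma>"
      "((1 / \<gamma>) *\<^sub>R y) \<bullet> y = (norm y)\<^sup>2 / \<gamma>"
      using \<gamma> by (simp_all add: power2_norm_eq_inner)
    ultimately have "(\<Sum>i\<in>UNIV. z \<bullet> (Q i *v z)) + (norm y)\<^sup>2 / \<gamma> + \<epsilon> * ((\<Sum>i\<in>UNIV. \<xi> i \<bullet> \<xi> i) + u \<bullet> u)
      \<le> (\<Sum>i\<in>UNIV. \<xi> i \<bullet> (Q i *v \<xi> i)) + \<gamma> * (u \<bullet> u)"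
      using form[where \<xi> = \<xi> and u = u and \<zeta> = "\<lambda>_. z" and \<eta> = "(1 / \<gamma>) *\<^sub>R y", folded z_def y_def] by (simp only: distrib_left)
    then show "(\<Sum>i\<in>UNIV. ((\<Sum>i\<in>UNIV. A i *v \<xi> i) + Eu *v u) \<bullet> (Q i *v ((\<Sum>i\<in>UNIV. A i *v \<xi> i) + Eu *v u)))
      + (norm ((\<Sum>i\<in>UNIV. C i *v \<xi> i) + Fu *v u))\<^sup>2 / \<gamma> + \<epsilon> * ((\<Sum>i\<in>UNIV. \<xi> i \<bullet> \<xi> i) + u \<bullet> u)
      \<le> (\<Sum>i\<in>UNIV. \<xi> i \<bullet> (Q i *v \<xi> i)) + \<gamma> * (u \<bullet> u)"
      unfolding z_def y_def .
  qed
qed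

lemma vcat_eq_0_iff: "vcat a b = 0 \<longleftrightarrow> a = 0 \<and> b = 0" for a b :: "real^_"
  by (auto simp: vec_eq_iff vcat_def split: sum.splits)

lemma blockvec_eq_0_iff: "blockvec m = 0 \<longleftrightarrow> (\<forall>i. m i = 0)"
  by (auto simp: vec_eq_iff blockvec_def)

text \<open>Converse of the Schur complement step. Completing squares bounds the coupling terms by
  the storage of \<open>z\<close> and \<open>(norm y)\<^sup>2 / \<gamma>\<close> plus the squares of
  the last two blocks. If the first two blocks vanish, so does the coupling, and the diagonal
  decides.\<close>

lemma L2_lmi_neg_def:
  fixes A :: "'i::finite \<Rightarrow> real^'n::finite^'n" and C :: "'i \<Rightarrow> real^'n^'y::finite"
    and Eu :: "real^'u::finite^'n" and Fu :: "real^'u^'y"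
  assumes Q: "\<And>i. pos_def (Q i)" and \<gamma>: "0 < \<gamma>"
    and lt: "\<And>\<xi> u. (\<exists>i. \<xi> i \<noteq> 0) \<or> u \<noteq> 0 \<Longrightarrow>
      (\<Sum>i\<in>UNIV. ((\<Sum>i\<in>UNIV. A i *v \<xi> i) + Eu *v u) \<bullet> (Q i *v ((\<Sum>i\<in>UNIV. A i *v \<xi> i) + Eu *v u)))
      + (norm ((\<Sum>i\<in>UNIV. C i *v \<xi> i) + Fu *v u))\<^sup>2 / \<gamma>
      < (\<Sum>i\<in>UNIV. \<xi> i \<bullet> (Q i *v \<xi> i)) + \<gamma> * (u \<bullet> u)"
  shows "neg_def (L2_lmi A C Eu Fu Q \<gamma>)"
  unfolding neg_def_def
proof (intro conjI allI impI)
  have sym: "transpose (Q i) = Q i" for i using Q by (simp add: pos_def_def)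
  show "transpose (L2_lmi A C Eu Fu Q \<gamma>) = L2_lmi A C Eu Fu Q \<gamma>"
    by (rule transpose_L2_lmi[OF sym])
  have psd: "0 \<le> w \<bullet> (Q i *v w)" for i w
    using Q[of i] by (cases "w = 0") (auto simp: pos_def_def less_imp_le)
  fix v :: "real^(('i \<times> 'n + 'u) + ('i \<times> 'n + 'y))" assume "v \<noteq> 0"
  obtain \<xi> u \<zeta> \<eta> where v: "v = vcat (vcat (blockvec \<xi>) u) (vcat (blockvec \<zeta>) \<eta>)"
    using vcat_surj blockvec_surj by metis
  define z where "z = (\<Sum>i\<in>UNIV. A i *v \<xi> i) + Eu *v u"
  define y where "y = (\<Sum>i\<in>UNIV. C i *v \<xi> i) + Fu *v u"
  have form: "v \<bullet> (L2_lmi A C Eu Fu Q \<gamma> *v v) =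
    2 * ((\<Sum>i\<in>UNIV. \<zeta> i \<bullet> (Q i *v z)) + \<eta> \<bullet> y)
    - (\<Sum>i\<in>UNIV. \<xi> i \<bullet> (Q i *v \<xi> i)) - \<gamma> * (u \<bullet> u)
    - (\<Sum>i\<in>UNIV. \<zeta> i \<bullet> (Q i *v \<zeta> i)) - \<gamma> * (\<eta> \<bullet> \<eta>)"
    unfolding v z_def y_def by (rule L2_lmi_form)
  show "v \<bullet> (L2_lmi A C Eu Fu Q \<gamma> *v v) < 0"
  proof (cases "(\<exists>i. \<xi> i \<noteq> 0) \<or> u \<noteq> 0")
    case True
    have "2 * (\<zeta> i \<bullet> (Q i *v z)) \<le> z \<bullet> (Q i *v z) + \<zeta> i \<bullet> (Q i *v \<zeta> i)" for i
    proof -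
      have "z \<bullet> (Q i *v \<zeta> i) = \<zeta> i \<bullet> (Q i *v z)"
        by (metis dot_lmul_matrix inner_commute sym transpose_matrix_vector)
      then show ?thesis using psd[of "z - \<zeta> i" i]
        by (simp add: matrix_vector_mult_diff_distrib inner_diff_left inner_diff_right)
    qed
    then have "2 * (\<Sum>i\<in>UNIV. \<zeta> i \<bullet> (Q i *v z))
        \<le> (\<Sum>i\<in>UNIV. z \<bullet> (Q i *v z)) + (\<Sum>i\<in>UNIV. \<zeta> i \<bullet> (Q i *v \<zeta> i))"
      by (simp add: sum_distrib_left sum.distrib[symmetric] sum_mono)
    moreover have "2 * (\<eta> \<bullet> y) \<le> (norm y)\<^sup>2 / \<gamma> + \<gamma> * (\<eta> \<bullet> \<eta>)"
    proof -
      have "0 \<le> \<gamma> * ((\<eta> - (1 / \<gamma>) *\<^sub>R y) \<bullet> (\<eta> - (1 / \<gamma>) *\<^sub>R y))" using \<gamma> by simp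
      also have "\<dots> = \<gamma> * (\<eta> \<bullet> \<eta>) - 2 * (\<eta> \<bullet> y) + (norm y)\<^sup>2 / \<gamma>" using \<gamma>
        by (simp add: inner_diff_left inner_diff_right power2_norm_eq_inner inner_commute[of y \<eta>] right_diff_distrib distrib_left)
      finally show ?thesis by simp
    qed
    moreover note lt[OF True, folded z_def y_def]
    ultimately show ?thesis unfolding form by (simp add: distrib_left)
  next
    case False
    then have \<xi>: "\<xi> = (\<lambda>_. 0)" and u: "u = 0" by auto
    then have zy: "z = 0" "y = 0" by (auto simp: z_def y_def)
    have "(\<exists>i. \<zeta> i \<noteq> 0) \<or> \<eta> \<noteq> 0"
      using \<open>v \<noteq> 0\<close> by (simp add: v vcat_eq_0_iff blockvec_eq_0_iff \<xi> u)
    then have "0 < (\<Sum>i\<in>UNIV. \<zeta> i \<bullet> (Q i *v \<zeta> i)) + \<gamma> * (\<eta> \<bullet> \<eta>)"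
    proof
      assume "\<exists>i. \<zeta> i \<noteq> 0"
      then obtain i where "0 < \<zeta> i \<bullet> (Q i *v \<zeta> i)" using Q by (auto simp: pos_def_def)
      then have "0 < (\<Sum>i\<in>UNIV. \<zeta> i \<bullet> (Q i *v \<zeta> i))" by (intro sum_pos2[of _ i]) (auto simp: psd)
      then show ?thesis using \<gamma> by (intro add_pos_nonneg) auto
    next
      assume "\<eta> \<noteq> 0"
      then show ?thesis using \<gamma> by (intro add_nonneg_pos sum_nonneg psd) auto
    qed
    then show ?thesis unfolding form by (simp add: \<xi> u zy)
  qed
qed

section \<open>Diagonal matrices and the Schur test\<close>

definition diag_mat :: "real^'n \<Rightarrow> real^'n^'n" where
  "diag_mat d = (\<chi> r c. if r = c then d $ r else 0)"

lemma diag_mat_mult: "diag_mat d *v x = d * x"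
  by (simp add: vec_eq_iff diag_mat_def matrix_vector_mult_def if_distrib[of "\<lambda>a. a * _"] cong: if_cong)

lemma is_diag_imp_diag_mat: "is_diag M \<Longrightarrow> M = diag_mat (\<chi> i. M $ i $ i)"
  by (auto simp: is_diag_def diag_mat_def vec_eq_iff)

lemma is_diag_diag_mat: "is_diag (diag_mat d)"
  by (simp add: is_diag_def diag_mat_def)

lemma diag_mat_form: "x \<bullet> (diag_mat d *v x) = (\<Sum>i\<in>UNIV. d $ i * (x $ i)\<^sup>2)"
  by (simp add: diag_mat_mult inner_vec_def power2_eq_square mult_ac)

lemma pos_def_diag_mat: "pos_def (diag_mat d) \<longleftrightarrow> vlt 0 d"
proof
  assume *: "pos_def (diag_mat d)"
  have "0 < d $ j" for j
  proof -
    have "(axis j 1 :: real^'a) \<noteq> 0" by (simp add: axis_eq_0_iff)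
    then have "0 < (axis j 1 :: real^'a) \<bullet> (diag_mat d *v axis j 1)" using * by (simp add: pos_def_def)
    also have "\<dots> = (\<Sum>i\<in>UNIV. if i = j then d $ i else 0)"
      unfolding diag_mat_form by (intro sum.cong) (auto simp: axis_def)
    finally show ?thesis by simp
  qed
  then show "vlt 0 d" by (simp add: vlt_def)
next
  assume d: "vlt 0 d"
  have "0 < x \<bullet> (diag_mat d *v x)" if x: "x \<noteq> 0" for x
  proof -
    obtain i where "x $ i \<noteq> 0" using x by (auto simp: vec_eq_iff)
    then show ?thesis unfolding diag_mat_form using d
      by (intro sum_pos2[of _ i]) (auto simp: vlt_def less_imp_le)
  qed
  moreover have "transpose (diag_mat d) = diag_mat d"
    by (auto simp: transpose_def diag_mat_def vec_eq_iff)
  ultimately show "pos_def (diag_mat d)" by (simp add: pos_def_def)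
qed

text \<open>Weighted Cauchy-Schwarz: splitting each entry of \<open>M\<close> into the square roots
  of \<open>M $ r $ c * p $ c\<close> and \<open>M $ r $ c / p $ c\<close> bounds each squared entry
  of \<open>M *v \<xi>\<close>. Exchanging the sums leaves the vector inequality for the single
  positive test vector \<open>p\<close>.\<close>

lemma schur_test:
  fixes M :: "real^'c^'r" and d :: "real^'r" and p e \<xi> :: "real^'c"
  assumes M: "nonneg_mat M" and p: "vlt 0 p" and d: "0 \<le> d"
    and lt: "vlt ((d * (M *v p)) v* M) (e * p)" and \<xi>: "\<xi> \<noteq> 0"
  shows "(\<Sum>r\<in>UNIV. d $ r * ((M *v \<xi>) $ r)\<^sup>2) < (\<Sum>c\<in>UNIV. e $ c * (\<xi> $ c)\<^sup>2)"
proof -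
  have pp: "0 < p $ c" for c using p by (simp add: vlt_def)
  have Mn: "0 \<le> M $ r $ c" for r c using M by (simp add: nonneg_mat_def)
  have cs: "((M *v \<xi>) $ r)\<^sup>2 \<le> (M *v p) $ r * (\<Sum>c\<in>UNIV. M $ r $ c * (\<xi> $ c)\<^sup>2 / p $ c)" for r
  proof -
    have "sqrt (M $ r $ c * p $ c) * (sqrt (M $ r $ c / p $ c) * \<xi> $ c) = M $ r $ c * \<xi> $ c" for c
    proof -
      have "M $ r $ c * p $ c * (M $ r $ c / p $ c) = (M $ r $ c)\<^sup>2"
        using pp[of c] by (simp add: power2_eq_square)
      then have "sqrt (M $ r $ c * p $ c) * sqrt (M $ r $ c / p $ c) = M $ r $ c"
        using Mn by (simp add: real_sqrt_mult[symmetric])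
      then show ?thesis by (simp add: mult.assoc[symmetric])
    qed
    then have expand: "(M *v \<xi>) $ r = (\<Sum>c\<in>UNIV. sqrt (M $ r $ c * p $ c) * (sqrt (M $ r $ c / p $ c) * \<xi> $ c))"
      by (simp only: matrix_vector_mult_def vec_lambda_beta)
    have "((M *v \<xi>) $ r)\<^sup>2 \<le> (\<Sum>c\<in>UNIV. (sqrt (M $ r $ c * p $ c))\<^sup>2)
        * (\<Sum>c\<in>UNIV. (sqrt (M $ r $ c / p $ c) * \<xi> $ c)\<^sup>2)"
      unfolding expand by (rule Cauchy_Schwarz_ineq_sum)
    also have "\<dots> = (M *v p) $ r * (\<Sum>c\<in>UNIV. M $ r $ c * (\<xi> $ c)\<^sup>2 / p $ c)"
      using Mn less_imp_le[OF pp] by (simp add: matrix_vector_mult_def power_mult_distrib)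
    finally show ?thesis .
  qed
  have "(\<Sum>r\<in>UNIV. d $ r * ((M *v \<xi>) $ r)\<^sup>2)
      \<le> (\<Sum>r\<in>UNIV. d $ r * ((M *v p) $ r * (\<Sum>c\<in>UNIV. M $ r $ c * (\<xi> $ c)\<^sup>2 / p $ c)))"
    using d cs by (intro sum_mono mult_left_mono) (auto simp: less_eq_vec_def)
  also have "\<dots> = (\<Sum>c\<in>UNIV. ((d * (M *v p)) v* M) $ c * ((\<xi> $ c)\<^sup>2 / p $ c))"
  proof -
    have "(\<Sum>c\<in>UNIV. ((d * (M *v p)) v* M) $ c * ((\<xi> $ c)\<^sup>2 / p $ c))
        = (\<Sum>c\<in>UNIV. \<Sum>r\<in>UNIV. d $ r * (M *v p) $ r * M $ r $ c * ((\<xi> $ c)\<^sup>2 / p $ c))"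
      by (simp only: vector_matrix_mult_def vec_lambda_beta sum_distrib_right vector_mult_component)
    also have "\<dots> = (\<Sum>r\<in>UNIV. \<Sum>c\<in>UNIV. d $ r * (M *v p) $ r * M $ r $ c * ((\<xi> $ c)\<^sup>2 / p $ c))"
      by (rule sum.swap)
    finally show ?thesis by (simp add: sum_distrib_left mult.assoc)
  qed
  also have "\<dots> < (\<Sum>c\<in>UNIV. (e * p) $ c * ((\<xi> $ c)\<^sup>2 / p $ c))"
  proof -
    \<comment> \<open>One nonzero coordinate suffices for strictness; all others contribute a weak
      inequality.\<close>
    obtain c where "\<xi> $ c \<noteq> 0" using \<xi> by (auto simp: vec_eq_iff)
    then have "0 < (\<xi> $ c)\<^sup>2 / p $ c" using pp by simp
    then have "((d * (M *v p)) v* M) $ c * ((\<xi> $ c)\<^sup>2 / p $ c) < (e * p) $ c * ((\<xi> $ c)\<^sup>2 / p $ c)"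
      using lt unfolding vlt_def by (intro mult_strict_right_mono) auto
    moreover have "((d * (M *v p)) v* M) $ c * ((\<xi> $ c)\<^sup>2 / p $ c) \<le> (e * p) $ c * ((\<xi> $ c)\<^sup>2 / p $ c)" for c
      using lt pp[of c] unfolding vlt_def
      by (intro mult_right_mono divide_nonneg_pos) (auto simp: less_imp_le)
    ultimately show ?thesis by (intro sum_strict_mono_ex1 ballI bexI[of _ c]) (simp_all only: finite UNIV_I)
  qed
  also have "\<dots> = (\<Sum>c\<in>UNIV. e $ c * (\<xi> $ c)\<^sup>2)"
    using pp by (intro sum.cong) (auto simp: less_imp_neq[symmetric])
  finally show ?thesis .
qed

lemma nonneg_mat_blk:
  "nonneg_mat M11 \<Longrightarrow> nonneg_mat M12 \<Longrightarrow> nonneg_mat M21 \<Longrightarrow> nonneg_mat M22 \<Longrightarrow> nonneg_mat (blk M11 M12 M21 M22)"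
  by (auto simp: nonneg_mat_def blk_def split: sum.split)

lemma nonneg_mat_blockrow: "(\<And>i. nonneg_mat (M i)) \<Longrightarrow> nonneg_mat (blockrow M)"
  by (simp add: nonneg_mat_def blockrow_def)

lemma vcat_times: "vcat a b * vcat c d = vcat (a * c) (b * d)" for a b c d :: "real^_"
  by (auto simp: vec_eq_iff vcat_def split: sum.split)

lemma blockvec_times: "blockvec m * blockvec m' = blockvec (\<lambda>i. m i * m' i)"
  for m m' :: "'i::finite \<Rightarrow> real^'n"
  by (simp add: vec_eq_iff blockvec_def)

section \<open>The matrix inequality and the L2-gain\<close>

context positive_delay_system
begin

text \<open>Because \<open>Q i\<close> is diagonal and positive, its form is monotone on nonnegative
  vectors. So \<open>v \<le> At *v v\<close> contradicts the dissipation inequality with all delayed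
  states equal to \<open>v\<close> and zero input, unless \<open>v = 0\<close>. For the gain, the
  inequality multiplied by \<open>\<gamma>\<close> has the storage functions
  \<open>\<gamma> * (x t \<bullet> (Q i *v x t))\<close>.\<close>

lemma L2_sufficient:
  assumes diag: "\<And>i. is_diag (Q i)" and pos: "\<And>i. pos_def (Q i)"
    and neg: "neg_def (L2_lmi A C Eu Fu Q \<gamma>)"
  shows "asym_stable A h" "L2_gain_lt A C Eu Fu h \<gamma>"
proof -
  have \<gamma>: "0 < \<gamma>" by (rule L2_lmi_imp(1)[OF neg])
  obtain \<epsilon> where \<epsilon>: "\<epsilon> > 0" and key: "\<And>\<xi> u.
      (\<Sum>i\<in>UNIV. ((\<Sum>i\<in>UNIV. A i *v \<xi> i) + Eu *v u) \<bullet> (Q i *v ((\<Sum>i\<in>UNIV. A i *v \<xi> i) + Eu *v u)))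
      + (norm ((\<Sum>i\<in>UNIV. C i *v \<xi> i) + Fu *v u))\<^sup>2 / \<gamma> + \<epsilon> * ((\<Sum>i\<in>UNIV. \<xi> i \<bullet> \<xi> i) + u \<bullet> u)
      \<le> (\<Sum>i\<in>UNIV. \<xi> i \<bullet> (Q i *v \<xi> i)) + \<gamma> * (u \<bullet> u)"
    using L2_lmi_imp(2)[OF neg] by blast
  define q where "q i = (\<chi> j. Q i $ j $ j)" for i
  have Q: "Q i = diag_mat (q i)" for i unfolding q_def by (rule is_diag_imp_diag_mat[OF diag])
  have q: "0 < q i $ j" for i j
    using pos[of i] by (simp add: Q pos_def_diag_mat vlt_def)
  have psd: "0 \<le> w \<bullet> (Q i *v w)" for i w
    by (simp add: Q diag_mat_form sum_nonneg less_imp_le[OF q])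
  have "\<exists>s. vlt 0 s \<and> vlt (s v* At) s"
  proof (rule nonneg_mat_alternative[OF At_nonneg])
    fix v :: "real^'n" assume v: "0 \<le> v" "v \<le> At *v v"
    have "v \<bullet> (Q i *v v) \<le> (At *v v) \<bullet> (Q i *v (At *v v))" for i
      using v less_imp_le[OF q]
      by (auto simp: Q diag_mat_form less_eq_vec_def intro!: sum_mono mult_left_mono power_mono)
    then have "(\<Sum>i\<in>UNIV. v \<bullet> (Q i *v v)) \<le> (\<Sum>i\<in>UNIV. (At *v v) \<bullet> (Q i *v (At *v v)))"
      by (rule sum_mono)
    moreover have "0 \<le> (norm (\<Sum>i\<in>UNIV. C i *v v))\<^sup>2 / \<gamma>" using \<gamma> by simp
    ultimately have "\<epsilon> * (real CARD('i) * (v \<bullet> v)) \<le> 0"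
      using key[of "\<lambda>_. v" 0] by (simp add: At_mult[symmetric])
    moreover have "0 < \<epsilon> * real CARD('i)" using \<epsilon> by simp
    ultimately show "v = 0"
      by (metis inner_gt_zero_iff mult.assoc mult_pos_pos not_less)
  qed
  then show "asym_stable A h" using vlt_left_imp_right[OF At_nonneg] asym_stable_if by blast
  \<comment> \<open>The squared gain: the margin lowers the input weight from
    \<open>\<gamma>\<close> to \<open>\<gamma> - \<epsilon>\<close>, and clearing the denominator
    multiplies by \<open>\<gamma>\<close>. The minimum keeps \<open>c\<close> nonnegative when
    \<open>\<epsilon>\<close> is large.\<close>
  define c where "c = \<gamma> * (\<gamma> - min \<epsilon> \<gamma>)"
  have c0: "0 \<le> c" using \<gamma> by (simp add: c_def)
  have "c < \<gamma>\<^sup>2" using \<gamma> \<epsilon> by (simp add: c_def power2_eq_square)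
  then have c_less: "sqrt c < \<gamma>" using \<gamma> by (metis real_sqrt_less_mono real_sqrt_abs abs_of_pos)
  have "L2_sig (sys_output C Fu h u x) \<and> L2_norm (sys_output C Fu h u x) \<le> sqrt c * L2_norm u"
    if u: "L2_sig u" and x0: "\<forall>t<0. x t = 0" and x: "is_traj A Eu h u x" for u x
  proof -
    let ?y = "sys_output C Fu h u x"
    have um [measurable]: "u \<in> borel_measurable borel" using u by (simp add: L2_sig_def)
    have xm [measurable]: "x \<in> borel_measurable borel"
      using trajectory_measurable[OF um _ x] x0 by blast
    have ym [measurable]: "?y \<in> borel_measurable borel" by (rule sys_output_measurable[OF um xm])
    have meas: "(\<lambda>t. \<gamma> * (x t \<bullet> (Q i *v x t))) \<in> borel_measurable borel"
        "(\<lambda>t. (norm (?y t))\<^sup>2) \<in> borel_measurable borel"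
        "(\<lambda>t. (norm (u t))\<^sup>2) \<in> borel_measurable borel" for i
      by measurable
    have nonneg: "0 \<le> \<gamma> * (x t \<bullet> (Q i *v x t))" for i t using \<gamma> psd by simp
    have zero: "\<gamma> * (x t \<bullet> (Q i *v x t)) = 0" if "t < 0" for i t using x0 that by simp
    have diss: "(norm (?y t))\<^sup>2 + (\<Sum>i\<in>UNIV. \<gamma> * (x t \<bullet> (Q i *v x t)))
        \<le> (\<Sum>i\<in>UNIV. \<gamma> * (x (t - h i) \<bullet> (Q i *v x (t - h i)))) + c * (norm (u t))\<^sup>2" if t: "0 \<le> t" for t
    proof -
      let ?S = "\<Sum>i\<in>UNIV. x (t - h i) \<bullet> (Q i *v x (t - h i))"
      have "x t = (\<Sum>i\<in>UNIV. A i *v x (t - h i)) + Eu *v u t" using x t by (simp add: is_traj_def)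
      then have k: "(\<Sum>i\<in>UNIV. x t \<bullet> (Q i *v x t)) + (norm (?y t))\<^sup>2 / \<gamma>
          + \<epsilon> * ((\<Sum>i\<in>UNIV. x (t - h i) \<bullet> x (t - h i)) + u t \<bullet> u t) \<le> ?S + \<gamma> * (u t \<bullet> u t)"
        using key[of "\<lambda>i. x (t - h i)" "u t"] by (simp add: sys_output_def)
      have "min \<epsilon> \<gamma> * (u t \<bullet> u t) \<le> \<epsilon> * ((\<Sum>i\<in>UNIV. x (t - h i) \<bullet> x (t - h i)) + u t \<bullet> u t)"
        using \<epsilon> \<gamma> by (intro mult_mono) (auto intro!: sum_nonneg)
      with k have "(\<Sum>i\<in>UNIV. x t \<bullet> (Q i *v x t)) + (norm (?y t))\<^sup>2 / \<gamma> \<le> ?S + (\<gamma> - min \<epsilon> \<gamma>) * (u t \<bullet> u t)"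
        by (simp only: left_diff_distrib)
      then have "\<gamma> * ((\<Sum>i\<in>UNIV. x t \<bullet> (Q i *v x t)) + (norm (?y t))\<^sup>2 / \<gamma>)
          \<le> \<gamma> * (?S + (\<gamma> - min \<epsilon> \<gamma>) * (u t \<bullet> u t))"
        using \<gamma> by (intro mult_left_mono) auto
      then show ?thesis using \<gamma>
        by (simp add: distrib_left sum_distrib_left c_def power2_norm_eq_inner mult.assoc add.commute)
    qed
    have int: "set_integrable lborel {0..} (\<lambda>t. (norm (u t))\<^sup>2)" using u by (simp add: L2_sig_def)
    note dissipation_inequality[OF h_pos meas nonneg zero_le_power2 zero_le_power2 c0 zero diss int]
    then show ?thesis using ym
      by (simp add: L2_sig_def L2_norm_def real_sqrt_mult[symmetric])
  qed
  then show "L2_gain_lt A C Eu Fu h \<gamma>"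
    unfolding L2_gain_lt_def using c0 c_less by (intro exI[of _ "sqrt c"]) auto
qed

text \<open>The gain bound is squared so that both sides become integrals, with constant
  \<open>\<gamma>'\<^sup>2\<close>.\<close>

lemma L2_dcgain_le:
  assumes stable: "asym_stable A h" and R: "(mat 1 - At) ** R = mat 1" and \<gamma>': "0 \<le> \<gamma>'"
    and gain: "\<And>u x. L2_sig u \<Longrightarrow> (\<forall>t<0. x t = 0) \<Longrightarrow> is_traj A Eu h u x \<Longrightarrow>
        L2_sig (sys_output C Fu h u x) \<and> L2_norm (sys_output C Fu h u x) \<le> \<gamma>' * L2_norm u"
  shows "(norm (dcgain R *v v))\<^sup>2 \<le> \<gamma>'\<^sup>2 * (norm v)\<^sup>2"
proof (rule integral_gain_lower_bound[OF stable R])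
  show "continuous_on UNIV (\<lambda>y :: real^'y. (norm y)\<^sup>2)" by (intro continuous_intros)
  fix u :: "real \<Rightarrow> real^'u" and x :: "real \<Rightarrow> real^'n"
  assume *: "u \<in> borel_measurable borel" "set_integrable lborel {0..} (\<lambda>t. (norm (u t))\<^sup>2)"
    "\<forall>t<0. x t = 0" "is_traj A Eu h u x"
  let ?Iy = "LINT t:{0..}|lborel. (norm (sys_output C Fu h u x t))\<^sup>2"
  let ?Iu = "LINT t:{0..}|lborel. (norm (u t))\<^sup>2"
  have y: "set_integrable lborel {0..} (\<lambda>t. (norm (sys_output C Fu h u x t))\<^sup>2)" "sqrt ?Iy \<le> \<gamma>' * sqrt ?Iu"
    using gain[OF _ *(3,4)] *(1,2) by (auto simp: L2_sig_def L2_norm_def)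
  have pos: "0 \<le> ?Iy" "0 \<le> ?Iu"
    unfolding set_lebesgue_integral_def by (auto intro!: integral_nonneg_AE simp: indicator_def)
  have "(sqrt ?Iy)\<^sup>2 \<le> (\<gamma>' * sqrt ?Iu)\<^sup>2" using y(2) pos by (intro power_mono) auto
  then have "?Iy \<le> \<gamma>'\<^sup>2 * ?Iu" using pos by (simp add: power_mult_distrib)
  then show "set_integrable lborel {0..} (\<lambda>t. (norm (sys_output C Fu h u x t))\<^sup>2) \<and> ?Iy \<le> \<gamma>'\<^sup>2 * ?Iu"
    using y(1) by blast
qed simp_all

lemma L2_necessary:
  assumes stable: "asym_stable A h" and gain: "L2_gain_lt A C Eu Fu h \<gamma>"
  shows "\<exists>Q. (\<forall>i. is_diag (Q i) \<and> pos_def (Q i)) \<and> neg_def (L2_lmi A C Eu Fu Q \<gamma>)"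
proof -
  obtain R where R: "nonneg_mat R" "(mat 1 - At) ** R = mat 1" "R ** (mat 1 - At) = mat 1"
    using asym_stable_resolvent[OF stable] .
  obtain \<gamma>' where \<gamma>': "0 \<le> \<gamma>'" "\<gamma>' < \<gamma>"
    and gain': "\<And>u x. L2_sig u \<Longrightarrow> (\<forall>t<0. x t = 0) \<Longrightarrow> is_traj A Eu h u x \<Longrightarrow>
        L2_sig (sys_output C Fu h u x) \<and> L2_norm (sys_output C Fu h u x) \<le> \<gamma>' * L2_norm u"
    using gain unfolding L2_gain_lt_def by blast
  have \<gamma>: "0 < \<gamma>" using \<gamma>' by linarith
  define G where "G = dcgain R"
  have G: "nonneg_mat G" unfolding G_def dcgain_def
    using nonneg_mat_mult[OF nonneg_mat_mult[OF Ct_nonneg R(1)] Eu_nonneg] Fu_nonneg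
    by (simp add: nonneg_mat_def)
  have G_le: "(norm (G *v v))\<^sup>2 \<le> \<gamma>'\<^sup>2 * (norm v)\<^sup>2" for v
    unfolding G_def by (rule L2_dcgain_le[OF stable R(2) \<gamma>'(1) gain'])
  \<comment> \<open>A nonnegative vector with \<open>v \<le> K *v v\<close> would satisfy
    \<open>\<gamma>\<^sup>2 * (norm v)\<^sup>2 \<le> \<gamma>'\<^sup>2 * (norm v)\<^sup>2\<close>,
    so it is zero. The alternative then provides the positive input \<open>w\<close> with
    \<open>K *v w\<close> below \<open>w\<close>.\<close>
  define K where "K = (1 / \<gamma>\<^sup>2) *\<^sub>R (transpose G ** G)"
  have K_mult: "K *v v = (1 / \<gamma>\<^sup>2) *\<^sub>R ((G *v v) v* G)" for v
    by (simp add: K_def scaleR_matrix_vector_assoc[symmetric] matrix_vector_mul_assoc[symmetric])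
  have K: "nonneg_mat K"
    using nonneg_mat_mult[OF nonneg_mat_transpose[OF G] G] by (simp add: K_def nonneg_mat_def)
  have "\<exists>s. vlt 0 s \<and> vlt (s v* K) s"
  proof (rule nonneg_mat_alternative[OF K])
    fix v :: "real^'u" assume v: "0 \<le> v" "v \<le> K *v v"
    have "v \<bullet> v \<le> v \<bullet> (K *v v)" by (rule inner_mono_vec[OF v])
    also have "\<dots> = (norm (G *v v))\<^sup>2 / \<gamma>\<^sup>2"
      by (simp add: K_mult inner_commute[of v] dot_lmul_matrix power2_norm_eq_inner)
    also have "\<dots> \<le> \<gamma>'\<^sup>2 * (norm v)\<^sup>2 / \<gamma>\<^sup>2" by (intro divide_right_mono G_le) auto
    finally have "\<gamma>\<^sup>2 * (norm v)\<^sup>2 \<le> \<gamma>'\<^sup>2 * (norm v)\<^sup>2"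
      using \<gamma> by (simp add: power2_norm_eq_inner field_simps)
    moreover have "\<gamma>'\<^sup>2 < \<gamma>\<^sup>2" using \<gamma>' by (intro power_strict_mono) auto
    ultimately have "(norm v)\<^sup>2 \<le> 0" by (simp add: mult_le_cancel_right)
    then show "v = 0" by simp
  qed
  then obtain w where w: "vlt 0 w" "vlt (K *v w) w" using vlt_left_imp_right[OF K] by blast
  have w_nonneg: "0 \<le> w" using w(1) by (rule vlt_imp_le)
  have "vlt ((1 / \<gamma>) *\<^sub>R ((G *v w) v* G)) (\<gamma> *\<^sub>R w)"
    using w(2) \<gamma> by (simp add: K_mult vlt_def field_simps power2_eq_square)
  \<comment> \<open>The perturbing vector collects both effects of the slack on the input
    inequality: through the output of the perturbed state and through the perturbed costate.\<close>
  then obtain \<epsilon> where \<epsilon>: "\<epsilon> > 0" and \<epsilon>_lt: "vlt ((1 / \<gamma>) *\<^sub>R ((G *v w) v* G)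
      + \<epsilon> *\<^sub>R ((1 / \<gamma>) *\<^sub>R ((Ct *v (R *v 1)) v* G) + (1 v* R) v* Eu)) (\<gamma> *\<^sub>R w)"
    using vlt_perturb by blast
  txt \<open>
    The state \<open>x\<close> is the perturbed equilibrium under the constant input \<open>w\<close>, and \<open>s\<close> is the perturbed
    equilibrium costate driven by \<open>y / \<gamma>\<close>, split over the delays as \<open>s = (\<Sum>i. m i)\<close>. The weights
    \<open>q i = m i / x\<close> turn \<open>(x, w)\<close> into a certificate for the Schur test.
  \<close>
  define x where "x = R *v (Eu *v w + \<epsilon> *\<^sub>R 1)"
  have "(mat 1 - At) *v x = Eu *v w + \<epsilon> *\<^sub>R 1" by (simp add: x_def R matrix_vector_mul_assoc)
  then have x_eq: "x = At *v x + Eu *v w + \<epsilon> *\<^sub>R 1"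
    by (simp add: matrix_vector_mult_diff_rdistrib algebra_simps)
  have x0: "0 \<le> x" unfolding x_def using \<epsilon>
    by (intro nonneg_mat_mult_nonneg R(1) add_nonneg_nonneg Eu_nonneg w_nonneg ones_nonneg scaleR_nonneg_nonneg) auto
  have z_lt: "vlt (At *v x + Eu *v w) x" by (subst (2) x_eq) (simp add: vlt_def \<epsilon>)
  have "0 \<le> At *v x + Eu *v w"
    by (intro add_nonneg_nonneg nonneg_mat_mult_nonneg At_nonneg Eu_nonneg x0 w_nonneg)
  then have x_pos: "vlt 0 x" using z_lt vlt_le_trans by blast
  define y where "y = Ct *v x + Fu *v w"
  have y_eq: "y = G *v w + \<epsilon> *\<^sub>R (Ct *v (R *v 1))"
    by (simp add: y_def x_def G_def dcgain_mult matrix_vector_right_distrib matrix_vector_mult_scaleR)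
  have y0: "0 \<le> y" unfolding y_def
    by (intro add_nonneg_nonneg nonneg_mat_mult_nonneg Ct_nonneg Fu_nonneg x0 w_nonneg)
  define y' where "y' = (1 / \<gamma>) *\<^sub>R y"
  have y'0: "0 \<le> y'" unfolding y'_def using \<gamma> y0 by (intro scaleR_nonneg_nonneg) auto
  define s where "s = (y' v* Ct + \<epsilon> *\<^sub>R 1) v* R"
  have "s v* (mat 1 - At) = y' v* Ct + \<epsilon> *\<^sub>R 1" by (simp add: s_def vector_matrix_mul_assoc R)
  then have s_eq: "s = s v* At + y' v* Ct + \<epsilon> *\<^sub>R 1"
    by (simp add: vector_matrix_mult_diff_rdistrib algebra_simps)
  have s0: "0 \<le> s" unfolding s_def using \<epsilon>
    by (intro nonneg_mat_mult_nonneg_left R(1) add_nonneg_nonneg Ct_nonneg y'0 ones_nonneg scaleR_nonneg_nonneg) auto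
  define m where "m i = s v* A i + y' v* C i + (\<epsilon> / real CARD('i)) *\<^sub>R 1" for i
  have sum_m: "(\<Sum>k\<in>UNIV. m k) = s"
    by (subst s_eq) (simp add: m_def sum.distrib mult_At mult_Ct sum_constant_scaleR del: sum_constant)
  have m_lt: "vlt (s v* A i + y' v* C i) (m i)" for i using \<epsilon> by (simp add: vlt_def m_def)
  have "0 \<le> s v* A i + y' v* C i" for i
    by (intro add_nonneg_nonneg nonneg_mat_mult_nonneg_left A_nonneg C_nonneg s0 y'0)
  then have m_pos: "vlt 0 (m i)" for i using m_lt vlt_le_trans by blast
  have "s v* Eu + y' v* Fu = y' v* G + \<epsilon> *\<^sub>R ((1 v* R) v* Eu)"
    by (simp add: s_def G_def mult_dcgain vector_matrix_left_distrib scaleR_vector_matrix_assoc)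
  also have "\<dots> = (1 / \<gamma>) *\<^sub>R ((G *v w) v* G)
      + \<epsilon> *\<^sub>R ((1 / \<gamma>) *\<^sub>R ((Ct *v (R *v 1)) v* G) + (1 v* R) v* Eu)"
    by (simp add: y'_def y_eq vector_matrix_left_distrib scaleR_vector_matrix_assoc scaleR_add_right)
  finally have u_lt: "vlt (s v* Eu + y' v* Fu) (\<gamma> *\<^sub>R w)" using \<epsilon>_lt by simp
  define q where "q i = (\<chi> n. m i $ n / x $ n)" for i
  have xp: "0 < x $ n" for n using x_pos by (simp add: vlt_def)
  have q_pos: "vlt 0 (q i)" for i using m_pos[of i] xp by (simp add: vlt_def q_def)
  have qx: "q i * x = m i" for i using xp by (auto simp: vec_eq_iff q_def less_imp_neq[symmetric])
  define S where "S = (\<Sum>i\<in>UNIV. q i)"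
  have S0: "0 \<le> S" unfolding S_def by (intro sum_nonneg vlt_imp_le q_pos)
  have Sx: "S * x = s" by (simp add: S_def sum_distrib_right qx sum_m)
  \<comment> \<open>\<open>M\<close> sends delayed states and input to the new state and output. All
    storage functions see the same new state, so its weight is \<open>S\<close>, the sum of the
    \<open>q i\<close>, while each delayed state keeps its own \<open>q i\<close>.\<close>
  define M where "M = blk (blockrow A) Eu (blockrow C) Fu"
  define d where "d = vcat S ((1 / \<gamma>) *\<^sub>R (1 :: real^'y))"
  define p where "p = vcat (blockvec (\<lambda>_ :: 'i. x)) w"
  define e where "e = vcat (blockvec q) (\<gamma> *\<^sub>R (1 :: real^'u))"
  have M: "nonneg_mat M" unfolding M_def
    by (intro nonneg_mat_blk nonneg_mat_blockrow A_nonneg C_nonneg Eu_nonneg Fu_nonneg)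
  have p_pos: "vlt 0 p" using x_pos w(1)
    by (auto simp: p_def vlt_def vcat_def blockvec_def split: sum.split)
  have d0: "0 \<le> d" using S0 \<gamma> by (auto simp: d_def less_eq_vec_def vcat_def split: sum.split)
  have Mp: "M *v p = vcat (At *v x + Eu *v w) y"
    by (simp add: M_def p_def y_def blk_mult_vcat blockrow_mult_blockvec At_mult Ct_mult)
  have y'_eq: "((1 / \<gamma>) *\<^sub>R 1) * y = y'" by (simp add: y'_def vec_eq_iff)
  \<comment> \<open>The Schur test produces the weighted image of \<open>x\<close>; since that image
    is below \<open>x\<close>, it may be replaced by the costate \<open>S * x = s\<close>, for which
    the inequalities are already known.\<close>
  define z where "z = S * (At *v x + Eu *v w)"
  have z_le: "z \<le> s" unfolding z_def Sx[symmetric] using S0 vlt_imp_le[OF z_lt]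
    by (auto simp: less_eq_vec_def intro!: mult_left_mono)
  have zA: "z v* A i + y' v* C i \<le> s v* A i + y' v* C i" for i
    by (intro add_right_mono nonneg_mat_mono_left A_nonneg z_le)
  have zE: "z v* Eu + y' v* Fu \<le> s v* Eu + y' v* Fu"
    by (intro add_right_mono nonneg_mat_mono_left Eu_nonneg z_le)
  have "d * (M *v p) = vcat z y'"
    by (simp only: Mp d_def vcat_times y'_eq z_def)
  then have "(d * (M *v p)) v* M = vcat (blockvec (\<lambda>i. z v* A i + y' v* C i)) (z v* Eu + y' v* Fu)"
    by (simp add: M_def vcat_mult_blk mult_blockrow blockvec_add)
  moreover have "e * p = vcat (blockvec m) (\<gamma> *\<^sub>R w)"
    by (simp add: e_def p_def vcat_times blockvec_times qx)
  ultimately have lt: "vlt ((d * (M *v p)) v* M) (e * p)"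
    using vlt_le_trans[OF zA m_lt] vlt_le_trans[OF zE u_lt] by (simp add: vlt_vcat vlt_blockvec)
  have "neg_def (L2_lmi A C Eu Fu (\<lambda>i. diag_mat (q i)) \<gamma>)"
  proof (rule L2_lmi_neg_def)
    show "pos_def (diag_mat (q i))" for i using q_pos by (simp add: pos_def_diag_mat)
    show "0 < \<gamma>" by (rule \<gamma>)
    fix \<xi> :: "'i \<Rightarrow> real^'n" and u :: "real^'u"
    assume "(\<exists>i. \<xi> i \<noteq> 0) \<or> u \<noteq> 0"
    then have nz: "vcat (blockvec \<xi>) u \<noteq> 0" by (simp add: vcat_eq_0_iff blockvec_eq_0_iff)
    define z where "z = (\<Sum>i\<in>UNIV. A i *v \<xi> i) + Eu *v u"
    define y where "y = (\<Sum>i\<in>UNIV. C i *v \<xi> i) + Fu *v u"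
    have form: "(\<Sum>k\<in>UNIV. a $ k * (b $ k)\<^sup>2) = (a * b) \<bullet> b" for a b :: "real^'k::finite"
      by (simp add: inner_vec_def power2_eq_square mult.assoc)
    have "M *v vcat (blockvec \<xi>) u = vcat z y"
      by (simp add: M_def z_def y_def blk_mult_vcat blockrow_mult_blockvec)
    then have "(d * vcat z y) \<bullet> vcat z y < (e * vcat (blockvec \<xi>) u) \<bullet> vcat (blockvec \<xi>) u"
      using schur_test[OF M p_pos d0 lt nz] by (simp only: form)
    moreover have "(d * vcat z y) \<bullet> vcat z y = (\<Sum>i\<in>UNIV. z \<bullet> (diag_mat (q i) *v z)) + (norm y)\<^sup>2 / \<gamma>"
    proof -
      have "((1 / \<gamma>) *\<^sub>R 1) * y = (1 / \<gamma>) *\<^sub>R y" by (simp add: vec_eq_iff)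
      then show ?thesis
        by (simp add: d_def vcat_times inner_vcat S_def sum_distrib_right inner_sum_left
            diag_mat_mult power2_norm_eq_inner inner_commute[of z])
    qed
    moreover have "(e * vcat (blockvec \<xi>) u) \<bullet> vcat (blockvec \<xi>) u
        = (\<Sum>i\<in>UNIV. \<xi> i \<bullet> (diag_mat (q i) *v \<xi> i)) + \<gamma> * (u \<bullet> u)"
    proof -
      have "(\<gamma> *\<^sub>R 1) * u = \<gamma> *\<^sub>R u" by (simp add: vec_eq_iff)
      then show ?thesis
        by (simp add: e_def vcat_times inner_vcat blockvec_times inner_blockvec
            diag_mat_mult inner_commute[of "\<xi> _"])
    qed
    ultimately show "(\<Sum>i\<in>UNIV. ((\<Sum>i\<in>UNIV. A i *v \<xi> i) + Eu *v u) \<bullet> (diag_mat (q i) *v ((\<Sum>i\<in>UNIV. A i *v \<xi> i) + Eu *v u)))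
      + (norm ((\<Sum>i\<in>UNIV. C i *v \<xi> i) + Fu *v u))\<^sup>2 / \<gamma>
      < (\<Sum>i\<in>UNIV. \<xi> i \<bullet> (diag_mat (q i) *v \<xi> i)) + \<gamma> * (u \<bullet> u)"
      unfolding z_def y_def by simp
  qed
  then show ?thesis
    by (intro exI[of _ "\<lambda>i. diag_mat (q i)"]) (simp add: is_diag_diag_mat pos_def_diag_mat q_pos)
qed

end

section \<open>The three equivalences\<close>

context positive_delay_system
begin

lemma L1_iff:
  "asym_stable A h \<and> L1_gain_lt A C Eu Fu h \<gamma> \<longleftrightarrow>
    (\<exists>m. (\<forall>i. vlt 0 (m i)) \<and> (\<forall>i. vlt ((\<Sum>k\<in>UNIV. m k) v* A i + 1 v* C i) (m i)) \<and>
      vlt ((\<Sum>k\<in>UNIV. m k) v* Eu + 1 v* Fu) (\<gamma> *\<^sub>R 1))"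
  by (intro iffI) (use L1_necessary in blast, use L1_sufficient in blast)

lemma L2_iff:
  "asym_stable A h \<and> L2_gain_lt A C Eu Fu h \<gamma> \<longleftrightarrow>
    (\<exists>Q. (\<forall>i. is_diag (Q i) \<and> pos_def (Q i)) \<and> neg_def (L2_lmi A C Eu Fu Q \<gamma>))"
  by (intro iffI) (use L2_necessary in blast, use L2_sufficient in blast)

lemma Linf_iff:
  "asym_stable A h \<and> Linf_gain_lt A C Eu Fu h \<gamma> \<longleftrightarrow>
    (\<exists>m. (\<forall>i. vlt 0 (m i)) \<and> (\<forall>i. vlt ((\<Sum>k\<in>UNIV. A k *v m k) + Eu *v 1) (m i)) \<and>
      vlt ((\<Sum>k\<in>UNIV. C k *v m k) + Fu *v 1) (\<gamma> *\<^sub>R 1))"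
  by (intro iffI) (use Linf_necessary in blast, use Linf_sufficient in blast)

end

theorem theorem12:
  fixes A :: "'i::finite \<Rightarrow> real^'n::finite^'n"
    and C :: "'i \<Rightarrow> real^'n^'y::finite"
    and Eu :: "real^'u::finite^'n"
    and Fu :: "real^'u^'y"
    and h :: "'i \<Rightarrow> real"
    and \<gamma>1 \<gamma>2 \<gamma>inf :: real
  assumes "\<forall>i. nonneg_mat (A i)" and "\<forall>i. nonneg_mat (C i)"
    and "nonneg_mat Eu" and "nonneg_mat Fu"
    and "\<forall>i. 0 < h i"
  shows
   "(asym_stable A h \<and> L1_gain_lt A C Eu Fu h \<gamma>1 \<longleftrightarrow>
      (\<exists>\<mu> :: real^('i \<times> 'n). vlt 0 \<mu> \<and>
         vlt (vcat \<mu> (1 :: real^'y) v*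
                blk (ones_kron (mat 1) ** blockrow A) (ones_kron Eu) (blockrow C) Fu)
             (vcat \<mu> (\<gamma>1 *\<^sub>R (1 :: real^'u)))))
  \<and> (asym_stable A h \<and> L2_gain_lt A C Eu Fu h \<gamma>2 \<longleftrightarrow>
      (\<exists>Q :: 'i \<Rightarrow> real^'n^'n. (\<forall>i. is_diag (Q i) \<and> pos_def (Q i)) \<and>
         neg_def
           (blk (blk (- blockdiag Q) (0 :: real^'u^('i \<times> 'n)) 0 (- (\<gamma>2 *\<^sub>R mat 1)))
                (transpose (blk (blockcol Q ** blockrow A) (blockcol (\<lambda>i. Q i ** Eu))
                                (blockrow C) Fu))
                (blk (blockcol Q ** blockrow A) (blockcol (\<lambda>i. Q i ** Eu)) (blockrow C) Fu)
                (blk (- blockdiag Q) (0 :: real^'y^('i \<times> 'n)) 0 (- (\<gamma>2 *\<^sub>R mat 1))))))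
  \<and> (asym_stable A h \<and> Linf_gain_lt A C Eu Fu h \<gamma>inf \<longleftrightarrow>
      (\<exists>\<mu> :: real^('i \<times> 'n). vlt 0 \<mu> \<and>
         vlt (blk (ones_kron (mat 1) ** blockrow A) (ones_kron Eu) (blockrow C) Fu
                *v vcat \<mu> (1 :: real^'u))
             (vcat \<mu> (\<gamma>inf *\<^sub>R (1 :: real^'y)))))"
proof -
  interpret positive_delay_system A C Eu Fu h
    using assms by unfold_locales auto
  show ?thesis
    unfolding L1_lp_blocks Linf_lp_blocks L2_lmi_def[symmetric]
    by (intro conjI L1_iff L2_iff Linf_iff)
qed

end
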